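(* Let $k\ge1$. For generic $\bar\lambda_1,\dots,\bar\lambda_k$, $\bar\sigma_1^2,\dots,\bar\sigma_k^2$ and $\bar m_1,\dots,\bar m_k$, the polynomial system \[ h_i(\mu):=\sum_{\ell=1}^k\bar\lambda_\ell\, M_i(\mu_\ell,\bar\sigma_\ell^2)-\bar m_i=0,\qquad i=1,\dots,k, \] in the unknowns $\mu_1,\dots,\mu_k$ has finitely many complex solutions (i.e., the $\lambda$-weighted, known-variance Gaussian $k$-mixture model is algebraically identifiable from these moment equations), and the number of its complex solutions is $k!$.
   Context: Define polynomials $M_i(\mu,s)$ for $i\ge 0$ by $M_0=1$, $M_1=\mu$, $M_i=\mu M_{i-1}+(i-1)\,s\,M_{i-2}$ for $i\ge2$ ($M_i(\mu,\sigma^2)$ is the $i$-th moment of $\mathcal N(\mu,\sigma^2)$). Here the mixing weights and variances are known and only the means are unknown. "Generic" means outside a proper Zariski-closed subset of parameter space. *)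

theory Defs
  imports Complex_Main "HOL-Library.FuncSet"
begin

fun Mom :: "nat \<Rightarrow> complex \<Rightarrow> complex \<Rightarrow> complex" where
  "Mom 0 mu s = 1"
| "Mom (Suc 0) mu s = mu"
| "Mom (Suc (Suc n)) mu s = mu * Mom (Suc n) mu s + of_nat (Suc n) * s * Mom n mu s"

inductive poly_fun :: "((nat \<Rightarrow> complex) \<Rightarrow> complex) \<Rightarrow> bool" where
  pf_const: "poly_fun (\<lambda>x. c)"
| pf_var: "poly_fun (\<lambda>x. x v)"
| pf_add: "poly_fun p \<Longrightarrow> poly_fun q \<Longrightarrow> poly_fun (\<lambda>x. p x + q x)"
| pf_mult: "poly_fun p \<Longrightarrow> poly_fun q \<Longrightarrow> poly_fun (\<lambda>x. p x * q x)"

definition enc :: "nat \<Rightarrow> (nat \<Rightarrow> complex) \<Rightarrow> (nat \<Rightarrow> complex) \<Rightarrow> (nat \<Rightarrow> complex) \<Rightarrow> nat \<Rightarrow> complex" where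
  "enc k lam s m v = (if v < k then lam (v + 1)
                      else if v < 2 * k then s (v - k + 1)
                      else if v < 3 * k then m (v - 2 * k + 1) else 0)"

text \<open>A property holds generically: outside a proper Zariski-closed subset of C^(3k),
  i.e. on the complement of the zero set of some polynomial not vanishing identically.\<close>
definition generic :: "nat \<Rightarrow> ((nat \<Rightarrow> complex) \<Rightarrow> (nat \<Rightarrow> complex) \<Rightarrow> (nat \<Rightarrow> complex) \<Rightarrow> bool) \<Rightarrow> bool" where
  "generic k Q \<longleftrightarrow> (\<exists>P. poly_fun P \<and> (\<exists>lam s m. P (enc k lam s m) \<noteq> 0) \<and>
       (\<forall>lam s m. P (enc k lam s m) \<noteq> 0 \<longrightarrow> Q lam s m))"

definition hsys :: "nat \<Rightarrow> (nat \<Rightarrow> complex) \<Rightarrow> (nat \<Rightarrow> complex) \<Rightarrow> (nat \<Rightarrow> complex) \<Rightarrow> (nat \<Rightarrow> complex) \<Rightarrow> nat \<Rightarrow> complex" where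
  "hsys k lam s m mu i = (\<Sum>l=1..k. lam l * Mom i (mu l) (s l)) - m i"

definition solutions :: "nat \<Rightarrow> (nat \<Rightarrow> complex) \<Rightarrow> (nat \<Rightarrow> complex) \<Rightarrow> (nat \<Rightarrow> complex) \<Rightarrow> (nat \<Rightarrow> complex) set" where
  "solutions k lam s m = {mu \<in> {1..k} \<rightarrow>\<^sub>E UNIV. \<forall>i\<in>{1..k}. hsys k lam s m mu i = 0}"

end

theory Submission
  imports Defs "HOL-Computational_Algebra.Fundamental_Theorem_Algebra"
    "HOL-Computational_Algebra.Polynomial_FPS" "HOL-Combinatorics.Permutations"
begin

text \<open>
  Consider the map \<open>Y\<close> sending weights, variances and means to weights, variances and moments, and
  put \<open>d = k!\<close>. Counting monomials, with the \<open>i\<close>-th moment of weight \<open>i\<close>, shows that any \<open>d + 1\<close>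
  polynomials are linearly dependent over the polynomials in \<open>Y\<close>. Conversely the powers
  \<open>1, u, \<dots>, u^(d - 1)\<close> of the linear form \<open>u = \<Sum> l \<mu>\<^sub>l\<close> are independent: a relation can be
  specialised to unit weights and zero variances, where the moments become power sums and \<open>u\<close> takes
  \<open>k!\<close> different values under permutations of the means. Hence all coordinates are
  generically polynomials in \<open>u\<close> over the function field of the target, and the points of a generic
  fibre correspond to the roots of the minimal polynomial of \<open>u\<close>, which has degree \<open>d\<close> and
  generically simple roots.
\<close>


section \<open>Polynomial functions\<close>

text \<open>The obstacle to plain counting is that the moments also involve weights and variances,
  and their degree in these parameters grows with the order. The count therefore bounds the mean
  degree by N and the parameter degree by N^2: the quadratic bound absorbs the linear overhead of
  the moments, while enlarging N by a constant changes the number of monomials only by a factor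
  close to 1 for suitable N, so the ratio k! survives. Counting bounds the degree of the field
  extension only from above. Equality comes from the specialisation, whose difficulty is that a
  nontrivial relation can become trivial at the special parameters. Hence the parameters are fixed
  one at a time, and a relation that dies is first divided by the linear equation that killed it.
  All field theory is done with denominators cleared: an identity in the function field is an
  identity of polynomial functions, multiplied by a power of a common denominator
  \<open>D\<close>.\<close>

lemma poly_fun_cmult: "poly_fun p \<Longrightarrow> poly_fun (\<lambda>x. c * p x)"
  by (rule pf_mult[OF pf_const])

lemma poly_fun_diff:
  assumes "poly_fun p" "poly_fun q"
  shows "poly_fun (\<lambda>x. p x - q x)"
  using pf_add[OF assms(1) poly_fun_cmult[OF assms(2), of "-1"]] by simp

lemma poly_fun_power: "poly_fun p \<Longrightarrow> poly_fun (\<lambda>x. p x ^ i)"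
  by (induction i) (auto intro: pf_const pf_mult)

lemma poly_fun_sum: "(\<And>i. i \<in> A \<Longrightarrow> poly_fun (f i)) \<Longrightarrow> poly_fun (\<lambda>x. \<Sum>i\<in>A. f i x)"
  by (induction A rule: infinite_finite_induct) (auto intro: pf_const pf_add)

lemma poly_fun_prod: "(\<And>i. i \<in> A \<Longrightarrow> poly_fun (f i)) \<Longrightarrow> poly_fun (\<lambda>x. \<Prod>i\<in>A. f i x)"
  by (induction A rule: infinite_finite_induct) (auto intro: pf_const pf_mult)

lemma poly_fun_compose:
  assumes "poly_fun P" "\<And>v. poly_fun (\<lambda>x. Y x v)"
  shows "poly_fun (\<lambda>x. P (Y x))"
  using assms(1) by induction (auto intro: pf_const pf_add pf_mult assms(2))

lemma poly_fun_on_line: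
  assumes "poly_fun P"
  shows "\<exists>p. \<forall>t. P (\<lambda>v. a v + t * (b v - a v)) = poly p t"
  using assms
proof induction
  case (pf_const c)
  show ?case by (rule exI[of _ "[:c:]"]) simp
next
  case (pf_var v)
  show ?case by (rule exI[of _ "[:a v, b v - a v:]"]) simp
next
  case (pf_add p q)
  then show ?case by (metis poly_add)
next
  case (pf_mult p q)
  then show ?case by (metis poly_mult)
qed

text \<open>Affine subspaces, with the empty set allowed; this covers both the full space and its
  slices with some coordinates fixed.\<close>

definition line_closed :: "(nat \<Rightarrow> complex) set \<Rightarrow> bool" where
  "line_closed W \<longleftrightarrow> (\<forall>a\<in>W. \<forall>b\<in>W. \<forall>t. (\<lambda>v. a v + t * (b v - a v)) \<in> W)"

text \<open>Irreducibility of affine space: on the line joining \<open>a\<close> to \<open>b\<close>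
  both functions become nonzero univariate polynomials, so only finitely many points of the line are
  bad.\<close>

lemma poly_fun_common_nonzero:
  assumes "poly_fun P" "poly_fun Q" "line_closed W" "a \<in> W" "P a \<noteq> 0" "b \<in> W" "Q b \<noteq> 0"
  shows "\<exists>z\<in>W. P z \<noteq> 0 \<and> Q z \<noteq> 0"
proof -
  obtain p where p: "\<And>t. P (\<lambda>v. a v + t * (b v - a v)) = poly p t"
    using poly_fun_on_line[OF assms(1)] by metis
  obtain q where q: "\<And>t. Q (\<lambda>v. a v + t * (b v - a v)) = poly q t"
    using poly_fun_on_line[OF assms(2)] by metis
  have "p \<noteq> 0" using p[of 0] assms(5) by auto
  moreover have "q \<noteq> 0" using q[of 1] assms(7) by auto
  ultimately have "finite {t. poly (p * q) t = 0}" by (simp add: poly_roots_finite)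
  then obtain t where "poly (p * q) t \<noteq> 0"
    using infinite_UNIV_char_0 by (metis (mono_tags, lifting) UNIV_eq_I mem_Collect_eq)
  then show ?thesis
    using p[of t] q[of t] assms(3,4,6) unfolding line_closed_def
    by (metis mult_eq_0_iff poly_mult)
qed

lemma poly_fun_prod_nonzero:
  assumes "finite A" "line_closed W" "W \<noteq> {}"
    and "\<And>i. i \<in> A \<Longrightarrow> poly_fun (f i)" "\<And>i. i \<in> A \<Longrightarrow> \<exists>z\<in>W. f i z \<noteq> 0"
  shows "\<exists>z\<in>W. (\<Prod>i\<in>A. f i z) \<noteq> 0"
  using assms(1,4,5)
proof (induction A)
  case empty
  then show ?case using assms(3) by auto
next
  case (insert i A)
  obtain a b where "a \<in> W" "f i a \<noteq> 0" "b \<in> W" "(\<Prod>i\<in>A. f i b) \<noteq> 0"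
    using insert by (metis insertCI)
  then have "\<exists>z\<in>W. f i z \<noteq> 0 \<and> (\<Prod>i\<in>A. f i z) \<noteq> 0"
    using poly_fun_common_nonzero[of "f i" "\<lambda>z. \<Prod>i\<in>A. f i z" W a b] insert.prems assms(2)
    by (simp add: poly_fun_prod)
  then show ?case using insert.hyps by simp
qed

lemma poly_fun_mult_zero:
  assumes "poly_fun P" "poly_fun Q" "line_closed W" "\<exists>a\<in>W. P a \<noteq> 0" "\<forall>z\<in>W. P z * Q z = 0"
  shows "\<forall>z\<in>W. Q z = 0"
  using poly_fun_common_nonzero[OF assms(1-3)] assms(4,5) by (metis mult_eq_0_iff)

text \<open>C^n inside the sequences. A \<open>poly_fun\<close> may mention any variable, so the
  number of variables is enforced by zero tails.\<close>

definition vspace :: "nat \<Rightarrow> (nat \<Rightarrow> complex) set" where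
  "vspace n = {x. \<forall>v\<ge>n. x v = 0}"

lemma line_closed_vspace: "line_closed (vspace n)"
  by (simp add: line_closed_def vspace_def)

lemma vspace_not_empty: "vspace n \<noteq> {}"
  by (auto simp: vspace_def intro: exI[of _ "\<lambda>_. 0"])

section \<open>Generic fibres\<close>

text \<open>In terms of function fields, \<open>dep\<close> bounds the degree of C(x) over C(Y) by
  d, and \<open>indep\<close> says that \<open>u\<close> has degree at least d, so \<open>u\<close>
  is a primitive element. As \<open>d > 0\<close>, the case of a single coefficient at j = 0 also
  makes \<open>Y\<close> dominant.\<close>

locale generic_fibre =
  fixes n d :: nat and Y :: "(nat \<Rightarrow> complex) \<Rightarrow> nat \<Rightarrow> complex" and u :: "(nat \<Rightarrow> complex) \<Rightarrow> complex"
  assumes Y_poly: "poly_fun (\<lambda>x. Y x v)"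
    and Y_vspace: "Y x \<in> vspace n"
    and u_poly: "poly_fun u"
    and d_pos: "d > 0"
    and dep: "(\<And>j. poly_fun (g j)) \<Longrightarrow>
      \<exists>c. (\<forall>j. poly_fun (c j)) \<and> (\<exists>j\<le>d. \<exists>y\<in>vspace n. c j y \<noteq> 0) \<and>
          (\<forall>x\<in>vspace n. (\<Sum>j\<le>d. c j (Y x) * g j x) = 0)"
    and indep: "(\<And>j. poly_fun (c j)) \<Longrightarrow> (\<And>x. x \<in> vspace n \<Longrightarrow> (\<Sum>j<d. c j (Y x) * u x ^ j) = 0) \<Longrightarrow>
      j < d \<Longrightarrow> y \<in> vspace n \<Longrightarrow> c j y = 0"
begin

text \<open>The relation that \<open>dep\<close> gives among the d powers and \<open>g\<close> must
  involve \<open>g\<close>, since otherwise it would contradict \<open>indep\<close>.\<close>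

lemma powers_span:
  assumes "poly_fun g"
  shows "\<exists>D a. poly_fun D \<and> (\<forall>j. poly_fun (a j)) \<and> (\<exists>y\<in>vspace n. D y \<noteq> 0) \<and>
    (\<forall>x\<in>vspace n. D (Y x) * g x = (\<Sum>j<d. a j (Y x) * u x ^ j))"
proof -
  define h where "h j = (if j < d then (\<lambda>x. u x ^ j) else g)" for j
  have "poly_fun (h j)" for j
    by (simp add: h_def u_poly poly_fun_power assms)
  then obtain c where c: "\<And>j. poly_fun (c j)" "\<exists>j\<le>d. \<exists>y\<in>vspace n. c j y \<noteq> 0"
    and rel0: "\<And>x. x \<in> vspace n \<Longrightarrow> (\<Sum>j\<le>d. c j (Y x) * h j x) = 0"
    using dep[of h] by auto
  have rel: "(\<Sum>j<d. c j (Y x) * u x ^ j) + c d (Y x) * g x = 0" if "x \<in> vspace n" for x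
    using rel0[OF that] by (simp add: lessThan_Suc_atMost[symmetric] h_def)
  have "\<exists>y\<in>vspace n. c d y \<noteq> 0"
  proof (rule ccontr)
    assume "\<not> ?thesis"
    then have 0: "\<forall>y\<in>vspace n. c d y = 0" by auto
    then have "\<And>x. x \<in> vspace n \<Longrightarrow> (\<Sum>j<d. c j (Y x) * u x ^ j) = 0"
      using rel Y_vspace by force
    then have "c j y = 0" if "j < d" "y \<in> vspace n" for j y
      using indep[of c] c(1) that by blast
    with 0 c(2) show False by (metis le_neq_implies_less)
  qed
  moreover have "c d (Y x) * g x = (\<Sum>j<d. - c j (Y x) * u x ^ j)" if "x \<in> vspace n" for x
    using rel[OF that] by (simp add: sum_negf eq_neg_iff_add_eq_0 add.commute)
  moreover have "poly_fun (\<lambda>y. - c j y)" for j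
    using poly_fun_cmult[OF c(1), of "-1"] by simp
  ultimately show ?thesis
    using c(1) by (intro exI[of _ "c d"] exI[of _ "\<lambda>j y. - c j y"] conjI) auto
qed

end


section \<open>Lifting roots of the minimal polynomial to points of the fibre\<close>

locale generic_fibre_coords = generic_fibre +
  fixes D :: "(nat \<Rightarrow> complex) \<Rightarrow> complex" and a :: "nat \<Rightarrow> (nat \<Rightarrow> complex) \<Rightarrow> complex"
    and r :: "nat \<Rightarrow> nat \<Rightarrow> (nat \<Rightarrow> complex) \<Rightarrow> complex"
  assumes D_poly: "poly_fun D" and a_poly: "poly_fun (a j)" and r_poly: "poly_fun (r v j)"
    and D_nonzero: "\<exists>y\<in>vspace n. D y \<noteq> 0"
    and r_beyond: "v \<ge> n \<Longrightarrow> r v j = (\<lambda>y. 0)"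
    and u_relation: "x \<in> vspace n \<Longrightarrow> D (Y x) * u x ^ d = (\<Sum>j<d. a j (Y x) * u x ^ j)"
    and coord_relation: "x \<in> vspace n \<Longrightarrow> D (Y x) * x v = (\<Sum>j<d. r v j (Y x) * u x ^ j)"
begin

definition Z :: "((nat \<Rightarrow> complex) \<times> complex) set" where
  "Z = {(p, t). p \<in> vspace n \<and> D p \<noteq> 0 \<and> D p * t ^ d = (\<Sum>j<d. a j p * t ^ j)}"

definition point :: "(nat \<Rightarrow> complex) \<Rightarrow> complex \<Rightarrow> nat \<Rightarrow> complex" where
  "point p t v = (\<Sum>j<d. r v j p * t ^ j) / D p"

text \<open>Functions on \<open>Z\<close> that, up to a power of \<open>D\<close>, are represented
  by a remainder of degree below d in t. They turn out to form a ring containing the coordinates of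
  \<open>point\<close>, so every polynomial expression in these has such a remainder.\<close>

definition reducible :: "((nat \<Rightarrow> complex) \<Rightarrow> complex \<Rightarrow> complex) \<Rightarrow> bool" where
  "reducible \<Phi> \<longleftrightarrow> (\<exists>e b. (\<forall>j. poly_fun (b j)) \<and>
     (\<forall>p t. (p, t) \<in> Z \<longrightarrow> D p ^ e * \<Phi> p t = (\<Sum>j<d. b j p * t ^ j)))"

lemma reducibleI:
  assumes "\<And>j. poly_fun (b j)" "\<And>p t. (p, t) \<in> Z \<Longrightarrow> D p ^ e * \<Phi> p t = (\<Sum>j<d. b j p * t ^ j)"
  shows "reducible \<Phi>"
  using assms unfolding reducible_def by blast

lemma reducibleE:
  assumes "reducible \<Phi>"
  obtains b e where "\<And>j. poly_fun (b j)"
    "\<And>p t. (p, t) \<in> Z \<Longrightarrow> D p ^ e * \<Phi> p t = (\<Sum>j<d. b j p * t ^ j)"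
  using assms unfolding reducible_def by blast

lemma reducible_const: "reducible (\<lambda>p t. c)"
proof (rule reducibleI[of "\<lambda>j y. if j = 0 then c else 0" 0])
  show "poly_fun (\<lambda>y. if j = 0 then c else 0)" for j :: nat
    by (rule pf_const)
  show "D p ^ 0 * c = (\<Sum>j<d. (if j = 0 then c else 0) * t ^ j)" for p t
    using d_pos by (simp add: if_distribR if_distrib[of "\<lambda>x. x * _"] sum.delta cong: if_cong)
qed

lemma reducible_add:
  assumes "reducible \<Phi>" "reducible \<Psi>"
  shows "reducible (\<lambda>p t. \<Phi> p t + \<Psi> p t)"
proof -
  obtain b e where b: "\<And>j. poly_fun (b j)"
    "\<And>p t. (p, t) \<in> Z \<Longrightarrow> D p ^ e * \<Phi> p t = (\<Sum>j<d. b j p * t ^ j)"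
    using reducibleE[OF assms(1)] by blast
  obtain c f where c: "\<And>j. poly_fun (c j)"
    "\<And>p t. (p, t) \<in> Z \<Longrightarrow> D p ^ f * \<Psi> p t = (\<Sum>j<d. c j p * t ^ j)"
    using reducibleE[OF assms(2)] by blast
  show ?thesis
  proof (rule reducibleI[of "\<lambda>j p. D p ^ f * b j p + D p ^ e * c j p" "e + f"])
    show "poly_fun (\<lambda>p. D p ^ f * b j p + D p ^ e * c j p)" for j
      by (intro pf_add pf_mult poly_fun_power D_poly b c)
    fix p t assume Z: "(p, t) \<in> Z"
    have "D p ^ (e + f) * (\<Phi> p t + \<Psi> p t)
        = D p ^ f * (D p ^ e * \<Phi> p t) + D p ^ e * (D p ^ f * \<Psi> p t)"
      by (simp add: power_add algebra_simps)
    also have "\<dots> = (\<Sum>j<d. (D p ^ f * b j p + D p ^ e * c j p) * t ^ j)"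
      unfolding b(2)[OF Z] c(2)[OF Z] by (simp add: sum_distrib_left sum.distrib algebra_simps)
    finally show "D p ^ (e + f) * (\<Phi> p t + \<Psi> p t) = \<dots>" .
  qed
qed

lemma reducible_coeff_mult:
  assumes "poly_fun q" "reducible \<Phi>"
  shows "reducible (\<lambda>p t. q p * \<Phi> p t)"
proof -
  obtain b e where b: "\<And>j. poly_fun (b j)"
    "\<And>p t. (p, t) \<in> Z \<Longrightarrow> D p ^ e * \<Phi> p t = (\<Sum>j<d. b j p * t ^ j)"
    using reducibleE[OF assms(2)] by blast
  show ?thesis
  proof (rule reducibleI[of "\<lambda>j p. q p * b j p" e])
    show "poly_fun (\<lambda>p. q p * b j p)" for j
      by (intro pf_mult assms b)
    fix p t assume Z: "(p, t) \<in> Z"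
    have "D p ^ e * (q p * \<Phi> p t) = q p * (D p ^ e * \<Phi> p t)" by simp
    also have "\<dots> = (\<Sum>j<d. q p * b j p * t ^ j)"
      unfolding b(2)[OF Z] by (simp add: sum_distrib_left algebra_simps)
    finally show "D p ^ e * (q p * \<Phi> p t) = \<dots>" .
  qed
qed

lemma reducible_cancel:
  assumes "reducible (\<lambda>p t. D p ^ f * \<Phi> p t)"
  shows "reducible \<Phi>"
proof -
  obtain b e where b: "\<And>j. poly_fun (b j)"
    "\<And>p t. (p, t) \<in> Z \<Longrightarrow> D p ^ e * (D p ^ f * \<Phi> p t) = (\<Sum>j<d. b j p * t ^ j)"
    using reducibleE[OF assms] by blast
  show ?thesis
    by (rule reducibleI[of b "e + f"]) (use b in \<open>simp_all add: power_add mult.assoc\<close>)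
qed

lemma reducible_cong:
  assumes "reducible \<Phi>" "\<And>p t. (p, t) \<in> Z \<Longrightarrow> \<Phi> p t = \<Psi> p t"
  shows "reducible \<Psi>"
  using assms unfolding reducible_def by auto

lemma reducible_mult_var:
  assumes "reducible \<Phi>"
  shows "reducible (\<lambda>p t. t * \<Phi> p t)"
proof -
  obtain b e where b: "\<And>j. poly_fun (b j)"
    "\<And>p t. (p, t) \<in> Z \<Longrightarrow> D p ^ e * \<Phi> p t = (\<Sum>j<d. b j p * t ^ j)"
    using reducibleE[OF assms] by blast
  obtain d' where d': "d = Suc d'"
    using d_pos gr0_implies_Suc by blast
  \<comment> \<open>Multiplication by t shifts the coefficients; the term in \<open>t ^ d\<close>
    that arises is rewritten by the equation of \<open>Z\<close>, at the price of one factor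
    \<open>D\<close>.\<close>
  let ?b = "\<lambda>j p. (if j = 0 then 0 else D p * b (j - 1) p) + b d' p * a j p"
  show ?thesis
  proof (rule reducibleI[of ?b "Suc e"])
    show "poly_fun (?b j)" for j
      by (cases "j = 0") (auto intro!: pf_add pf_mult D_poly b a_poly)
    fix p t assume Z: "(p, t) \<in> Z"
    then have Z': "D p * t ^ d = (\<Sum>j<d. a j p * t ^ j)" by (simp add: Z_def)
    have "D p ^ Suc e * (t * \<Phi> p t) = D p * t * (D p ^ e * \<Phi> p t)" by simp
    also have "\<dots> = D p * t * (\<Sum>j<d. b j p * t ^ j)" by (simp add: b(2)[OF Z])
    also have "\<dots> = (\<Sum>j<d'. D p * b j p * t ^ Suc j) + b d' p * (D p * t ^ d)"
      by (simp add: d' algebra_simps sum_distrib_left)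
    also have "(\<Sum>j<d'. D p * b j p * t ^ Suc j) = (\<Sum>j<d. (if j = 0 then 0 else D p * b (j - 1) p) * t ^ j)"
      unfolding d' by (subst sum.lessThan_Suc_shift) simp
    also have "b d' p * (D p * t ^ d) = (\<Sum>j<d. b d' p * a j p * t ^ j)"
      by (simp add: Z' sum_distrib_left mult.assoc)
    finally show "D p ^ Suc e * (t * \<Phi> p t) = (\<Sum>j<d. ?b j p * t ^ j)"
      by (simp add: sum.distrib[symmetric] algebra_simps)
  qed
qed

lemma reducible_sum:
  assumes "\<And>i. i \<in> A \<Longrightarrow> reducible (\<Phi> i)"
  shows "reducible (\<lambda>p t. \<Sum>i\<in>A. \<Phi> i p t)"
  using assms
  by (induction A rule: infinite_finite_induct) (auto intro: reducible_const reducible_add)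

lemma reducible_mult_power:
  assumes "reducible \<Phi>"
  shows "reducible (\<lambda>p t. t ^ i * \<Phi> p t)"
proof (induction i)
  case (Suc i)
  show ?case using reducible_mult_var[OF Suc] by (simp add: mult.assoc)
qed (use assms in simp)

lemma reducible_mult:
  assumes "reducible \<Phi>" "reducible \<Psi>"
  shows "reducible (\<lambda>p t. \<Phi> p t * \<Psi> p t)"
proof -
  obtain b e where b: "\<And>j. poly_fun (b j)"
    "\<And>p t. (p, t) \<in> Z \<Longrightarrow> D p ^ e * \<Phi> p t = (\<Sum>j<d. b j p * t ^ j)"
    using reducibleE[OF assms(1)] by blast
  have "reducible (\<lambda>p t. \<Sum>j<d. b j p * (t ^ j * \<Psi> p t))"
    by (intro reducible_sum reducible_coeff_mult b reducible_mult_power assms)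
  then have "reducible (\<lambda>p t. D p ^ e * (\<Phi> p t * \<Psi> p t))"
    by (rule reducible_cong) (simp add: mult.assoc[symmetric] b(2) sum_distrib_right)
  then show ?thesis by (rule reducible_cancel)
qed

lemma reducible_coord: "reducible (\<lambda>p t. point p t v)"
proof (rule reducibleI[of "r v" 1])
  show "D p ^ 1 * point p t v = (\<Sum>j<d. r v j p * t ^ j)" if "(p, t) \<in> Z" for p t
    using that by (simp add: Z_def point_def)
qed (rule r_poly)

lemma reducible_poly_fun:
  assumes "poly_fun G"
  shows "reducible (\<lambda>p t. G (point p t))"
  using assms
  by induction (auto intro: reducible_const reducible_coord reducible_add reducible_mult)

lemma reducible_param: "reducible (\<lambda>p t. p v)"
  using reducible_coeff_mult[OF pf_var reducible_const[of 1], of v] by simp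

lemma reducible_var: "reducible (\<lambda>p t. t)"
  using reducible_mult_var[OF reducible_const[of 1]] by simp

lemma reducible_diff:
  assumes "reducible \<Phi>" "reducible \<Psi>"
  shows "reducible (\<lambda>p t. \<Phi> p t - \<Psi> p t)"
  using reducible_add[OF assms(1) reducible_mult[OF reducible_const[of "-1"] assms(2)]] by simp

lemma graph_in_Z:
  assumes "x \<in> vspace n" "D (Y x) \<noteq> 0"
  shows "(Y x, u x) \<in> Z"
  using assms u_relation Y_vspace by (simp add: Z_def)

text \<open>A reduced expression vanishing on the graph of \<open>u\<close> has zero coefficients by independence
  of the powers of \<open>u\<close>, so identities pass from points \<open>x\<close> to roots \<open>t\<close>.\<close>
lemma reducible_vanishes:
  assumes "reducible \<Phi>" "\<And>x. x \<in> vspace n \<Longrightarrow> D (Y x) \<noteq> 0 \<Longrightarrow> \<Phi> (Y x) (u x) = 0" "(p, t) \<in> Z"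
  shows "\<Phi> p t = 0"
proof -
  obtain b e where b: "\<And>j. poly_fun (b j)"
    "\<And>p t. (p, t) \<in> Z \<Longrightarrow> D p ^ e * \<Phi> p t = (\<Sum>j<d. b j p * t ^ j)"
    using reducibleE[OF assms(1)] by blast
  have p: "p \<in> vspace n" "D p \<noteq> 0"
    using assms(3) by (auto simp: Z_def)
  \<comment> \<open>The extra factor \<open>D\<close> makes the relation hold also where
    \<open>D (Y x) = 0\<close>, because \<open>indep\<close> asks for it at every point.\<close>
  have "(\<Sum>j<d. D (Y x) * b j (Y x) * u x ^ j) = 0" if x: "x \<in> vspace n" for x
  proof (cases "D (Y x) = 0")
    case False
    have "(\<Sum>j<d. b j (Y x) * u x ^ j) = 0"
      using b(2)[OF graph_in_Z[OF x False]] assms(2)[OF x False] by simp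
    then show ?thesis by (simp add: mult.assoc sum_distrib_left[symmetric])
  qed simp
  then have "D p * b j p = 0" if "j < d" for j
    using indep[of "\<lambda>j y. D y * b j y"] pf_mult[OF D_poly b(1)] that p(1) by blast
  then have "D p ^ e * \<Phi> p t = 0"
    using b(2)[OF assms(3)] p(2) by simp
  then show ?thesis using p(2) by simp
qed

lemma point_graph:
  assumes "x \<in> vspace n" "D (Y x) \<noteq> 0"
  shows "point (Y x) (u x) = x"
  using coord_relation[OF assms(1)] assms(2) by (auto simp: point_def fun_eq_iff field_simps)

lemma point_vspace: "point p t \<in> vspace n"
  by (simp add: vspace_def point_def r_beyond)

text \<open>On the graph of \<open>u\<close> the map \<open>point\<close> returns x itself, so the
  identity is trivial there and transfers to every root.\<close>

lemma Y_point:
  assumes "(p, t) \<in> Z"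
  shows "Y (point p t) = p"
proof
  fix v
  have "Y (point p t) v - p v = 0"
    by (rule reducible_vanishes[of "\<lambda>p t. Y (point p t) v - p v", OF _ _ assms])
       (auto intro!: reducible_diff reducible_poly_fun[OF Y_poly] reducible_param simp: point_graph)
  then show "Y (point p t) v = p v" by simp
qed

lemma u_point:
  assumes "(p, t) \<in> Z"
  shows "u (point p t) = t"
proof -
  have "u (point p t) - t = 0"
    by (rule reducible_vanishes[of "\<lambda>p t. u (point p t) - t", OF _ _ assms])
       (auto intro!: reducible_diff reducible_poly_fun[OF u_poly] reducible_var simp: point_graph)
  then show ?thesis by simp
qed

lemma bij_betw_fibre:
  assumes "p \<in> vspace n" "D p \<noteq> 0"
  shows "bij_betw (point p) {t. (p, t) \<in> Z} {x \<in> vspace n. Y x = p}"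
  by (rule bij_betw_byWitness[of _ u])
     (use assms in \<open>auto simp: u_point point_graph Y_point point_vspace graph_in_Z\<close>)

section \<open>The minimal polynomial and its simple roots\<close>

definition q :: "nat \<Rightarrow> (nat \<Rightarrow> complex) \<Rightarrow> complex" where
  "q j p = (if j = d then D p else - a j p)"

definition Q :: "(nat \<Rightarrow> complex) \<Rightarrow> complex poly" where
  "Q p = (\<Sum>j\<le>d. monom (q j p) j)"

lemma q_poly: "poly_fun (q j)"
  using poly_fun_cmult[OF a_poly, of "-1" j] D_poly by (cases "j = d") (auto simp: q_def[abs_def])

lemma poly_Q: "poly (Q p) t = D p * t ^ d - (\<Sum>j<d. a j p * t ^ j)"
proof -
  have "poly (Q p) t = (\<Sum>j<d. q j p * t ^ j) + q d p * t ^ d"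
    by (simp add: Q_def poly_sum poly_monom lessThan_Suc_atMost[symmetric])
  also have "(\<Sum>j<d. q j p * t ^ j) = - (\<Sum>j<d. a j p * t ^ j)"
    by (simp add: q_def sum_negf)
  finally show ?thesis by (simp add: q_def)
qed

lemma Z_iff: "p \<in> vspace n \<Longrightarrow> D p \<noteq> 0 \<Longrightarrow> (p, t) \<in> Z \<longleftrightarrow> poly (Q p) t = 0"
  by (simp add: Z_def poly_Q)

lemma poly_pderiv_Q: "poly (pderiv (Q p)) t = (\<Sum>j<d. of_nat (Suc j) * q (Suc j) p * t ^ j)"
proof -
  have "poly (pderiv (Q p)) t = (\<Sum>j\<le>d. of_nat j * q j p * t ^ (j - 1))"
    using higher_pderiv_sum[of 1 "\<lambda>j. monom (q j p) j" "{..d}"]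
    by (simp add: Q_def pderiv_monom poly_sum poly_monom)
  also have "\<dots> = (\<Sum>j<d. of_nat (Suc j) * q (Suc j) p * t ^ j)"
    by (subst sum.atMost_shift) simp
  finally show ?thesis .
qed

lemma degree_Q:
  assumes "D p \<noteq> 0"
  shows "degree (Q p) = d"
proof (rule antisym)
  show "degree (Q p) \<le> d"
    unfolding Q_def by (rule degree_sum_le) (auto intro: order_trans[OF degree_monom_le])
  have "coeff (Q p) d = D p"
    by (simp add: Q_def coeff_sum q_def sum.delta)
  then show "d \<le> degree (Q p)"
    using assms by (intro le_degree) simp
qed

text \<open>The value \<open>w\<close> of the derivative of \<open>Q\<close> on the graph is a nonzero polynomial function, hence
  satisfies a relation over the \<open>Y\<close>-polynomials with nonzero constant term; that term detects
  multiple roots.\<close>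
lemma generically_squarefree:
  obtains c where "poly_fun c" "\<exists>y\<in>vspace n. c y \<noteq> 0"
    "\<And>p. p \<in> vspace n \<Longrightarrow> D p \<noteq> 0 \<Longrightarrow> c p \<noteq> 0 \<Longrightarrow> rsquarefree (Q p)"
proof -
  define w where "w x = (\<Sum>j<d. of_nat (Suc j) * q (Suc j) (Y x) * u x ^ j)" for x
  have w_poly: "poly_fun w"
    unfolding w_def[abs_def]
    by (intro poly_fun_sum pf_mult pf_const poly_fun_power u_poly poly_fun_compose[OF q_poly] Y_poly)
  have w_nz: "\<exists>x\<in>vspace n. w x \<noteq> 0"
  proof (rule ccontr)
    assume "\<not> ?thesis"
    then have "\<And>x. x \<in> vspace n \<Longrightarrow> (\<Sum>j<d. of_nat (Suc j) * q (Suc j) (Y x) * u x ^ j) = 0"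
      by (auto simp: w_def)
    \<comment> \<open>The leading coefficient of the derivative is d times \<open>D\<close>;
      \<open>indep\<close> would force it to vanish.\<close>
    then have "of_nat (Suc (d - 1)) * q (Suc (d - 1)) y = 0" if "y \<in> vspace n" for y
      using indep[of "\<lambda>j y. of_nat (Suc j) * q (Suc j) y" "d - 1" y] poly_fun_cmult[OF q_poly] that d_pos
      by simp
    then have "D y = 0" if "y \<in> vspace n" for y
      using that d_pos by (simp add: q_def)
    then show False using D_nonzero by blast
  qed
  have "\<exists>c. (\<forall>j. poly_fun (c j)) \<and> (\<exists>j\<le>d. \<exists>y\<in>vspace n. c j y \<noteq> 0) \<and>
      (\<forall>x\<in>vspace n. (\<Sum>j\<le>d. c j (Y x) * w x ^ j) = 0)"
    by (rule dep) (rule poly_fun_power[OF w_poly])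
  then obtain c where c: "\<And>j. poly_fun (c j)" "\<exists>j\<le>d. \<exists>y\<in>vspace n. c j y \<noteq> 0"
    and rel: "\<And>x. x \<in> vspace n \<Longrightarrow> (\<Sum>j\<le>d. c j (Y x) * w x ^ j) = 0"
    by auto
  \<comment> \<open>The relation may begin with zero coefficients. Cancelling \<open>w x ^ m\<close>
    removes them, since \<open>w\<close> is not identically zero and \<open>vspace n\<close> is
    irreducible.\<close>
  define m where "m = (LEAST j. j \<le> d \<and> (\<exists>y\<in>vspace n. c j y \<noteq> 0))"
  have m: "m \<le> d" "\<exists>y\<in>vspace n. c m y \<noteq> 0"
    using LeastI_ex[OF c(2)] by (auto simp: m_def)
  have below: "c j y = 0" if "j < m" "y \<in> vspace n" for j y
    using not_less_Least[of j "\<lambda>j. j \<le> d \<and> (\<exists>y\<in>vspace n. c j y \<noteq> 0)"] that m(1)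
    unfolding m_def[symmetric] by (meson less_imp_le order_trans)
  define s where "s x = (\<Sum>j\<in>{m..d}. c j (Y x) * w x ^ (j - m))" for x
  have s_poly: "poly_fun s"
    unfolding s_def[abs_def]
    by (intro poly_fun_sum pf_mult poly_fun_power w_poly poly_fun_compose[OF c(1)] Y_poly)
  have "w x ^ m * s x = 0" if x: "x \<in> vspace n" for x
  proof -
    have "w x ^ m * s x = (\<Sum>j\<in>{m..d}. c j (Y x) * w x ^ j)"
      unfolding s_def sum_distrib_left
      by (rule sum.cong) (auto simp: power_add[symmetric] mult.left_commute)
    also have "\<dots> = (\<Sum>j\<le>d. c j (Y x) * w x ^ j)"
      by (rule sum.mono_neutral_left) (auto simp: below Y_vspace)
    finally show ?thesis using rel[OF x] by simp
  qed
  then have s0: "\<forall>x\<in>vspace n. s x = 0"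
    using poly_fun_mult_zero[OF poly_fun_power[OF w_poly, of m] s_poly line_closed_vspace] w_nz by auto
  show thesis
  proof (rule that[of "c m"])
    show "poly_fun (c m)" "\<exists>y\<in>vspace n. c m y \<noteq> 0" using c m by auto
    fix p assume p: "p \<in> vspace n" "D p \<noteq> 0" "c m p \<noteq> 0"
    show "rsquarefree (Q p)"
      unfolding rsquarefree_roots
    proof (intro allI notI)
      \<comment> \<open>At a double root \<open>w\<close> vanishes at the corresponding fibre point,
        so only the constant term \<open>c m p\<close> of \<open>s\<close> survives there.\<close>
      fix t assume t: "poly (Q p) t = 0 \<and> poly (pderiv (Q p)) t = 0"
      then have Z: "(p, t) \<in> Z" using Z_iff p by blast
      have "w (point p t) = 0"
        using t by (simp add: w_def Y_point[OF Z] u_point[OF Z] poly_pderiv_Q)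
      then have "s (point p t) = (\<Sum>j\<in>{m..d}. if j = m then c m p else 0)"
        unfolding s_def by (intro sum.cong) (auto simp: Y_point[OF Z])
      also have "\<dots> = c m p" using m(1) by simp
      finally show False using s0 point_vspace p(3) by simp
    qed
  qed
qed

lemma card_generic_fibre_coords:
  "\<exists>P. poly_fun P \<and> (\<exists>y\<in>vspace n. P y \<noteq> 0) \<and>
     (\<forall>y\<in>vspace n. P y \<noteq> 0 \<longrightarrow> finite {x \<in> vspace n. Y x = y} \<and> card {x \<in> vspace n. Y x = y} = d)"
proof -
  obtain c where c: "poly_fun c" "\<exists>y\<in>vspace n. c y \<noteq> 0"
    "\<And>p. p \<in> vspace n \<Longrightarrow> D p \<noteq> 0 \<Longrightarrow> c p \<noteq> 0 \<Longrightarrow> rsquarefree (Q p)"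
    using generically_squarefree by blast
  have fibre: "finite {x \<in> vspace n. Y x = p} \<and> card {x \<in> vspace n. Y x = p} = d"
    if p: "p \<in> vspace n" "D p * c p \<noteq> 0" for p
  proof -
    have nz: "D p \<noteq> 0" "c p \<noteq> 0" using p by auto
    have bij: "bij_betw (point p) {t. poly (Q p) t = 0} {x \<in> vspace n. Y x = p}"
      using bij_betw_fibre[OF p(1) nz(1)] by (simp add: Z_iff p(1) nz(1))
    have "Q p \<noteq> 0" using degree_Q[OF nz(1)] d_pos by auto
    then have fin: "finite {t. poly (Q p) t = 0}" by (rule poly_roots_finite)
    have "smult (lead_coeff (Q p)) (\<Prod>z | poly (Q p) z = 0. [:- z, 1:]) = Q p"
      by (rule complex_poly_decompose_rsquarefree) (use c(3) p nz in auto)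
    then have "d = degree (\<Prod>z | poly (Q p) z = 0. [:- z, 1:])"
      using degree_Q[OF nz(1)] \<open>Q p \<noteq> 0\<close> by (metis degree_smult_eq leading_coeff_0_iff)
    also have "\<dots> = card {t. poly (Q p) t = 0}"
      by (subst degree_prod_sum_eq) auto
    finally show ?thesis
      using bij_betw_finite[OF bij] bij_betw_same_card[OF bij] fin by simp
  qed
  have "\<exists>y\<in>vspace n. D y * c y \<noteq> 0"
    using poly_fun_common_nonzero[OF D_poly c(1) line_closed_vspace] D_nonzero c(2)
    by (metis mult_eq_0_iff)
  then show ?thesis
    using pf_mult[OF D_poly c(1)] fibre by (intro exI[of _ "\<lambda>y. D y * c y"] conjI[OF _ conjI] ballI impI)
qed

end

theorem (in generic_fibre) card_generic_fibre:
  "\<exists>P. poly_fun P \<and> (\<exists>y\<in>vspace n. P y \<noteq> 0) \<and>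
     (\<forall>y\<in>vspace n. P y \<noteq> 0 \<longrightarrow> finite {x \<in> vspace n. Y x = y} \<and> card {x \<in> vspace n. Y x = y} = d)"
proof -
  obtain D' A where D': "poly_fun D'" "\<exists>y\<in>vspace n. D' y \<noteq> 0" and A: "\<And>j. poly_fun (A j)"
    and u_rel: "\<And>x. x \<in> vspace n \<Longrightarrow> D' (Y x) * u x ^ d = (\<Sum>j<d. A j (Y x) * u x ^ j)"
    using powers_span[OF poly_fun_power[OF u_poly, of d]] by blast
  have "\<exists>E R. poly_fun E \<and> (\<forall>j. poly_fun (R j)) \<and> (\<exists>y\<in>vspace n. E y \<noteq> 0) \<and>
      (\<forall>x\<in>vspace n. E (Y x) * x v = (\<Sum>j<d. R j (Y x) * u x ^ j))" for v
    by (rule powers_span[OF pf_var])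
  then obtain E R where E: "\<And>v. poly_fun (E v)" "\<And>v. \<exists>y\<in>vspace n. E v y \<noteq> 0"
    and R: "\<And>v j. poly_fun (R v j)"
    and rel: "\<And>v x. x \<in> vspace n \<Longrightarrow> E v (Y x) * x v = (\<Sum>j<d. R v j (Y x) * u x ^ j)"
    by metis
  \<comment> \<open>Each coordinate and \<open>u ^ d\<close> come with their own denominator;
    \<open>D\<close> is the product of all of them, and each numerator takes the factors that its
    own denominator misses.\<close>
  define D where "D y = D' y * (\<Prod>v<n. E v y)" for y
  define a where "a j y = (\<Prod>v<n. E v y) * A j y" for j y
  define r where "r v j y = (if v < n then D' y * (\<Prod>w\<in>{..<n} - {v}. E w y) * R v j y else 0)" for v j y
  interpret generic_fibre_coords n d Y u D a r
  proof
    show "poly_fun D" unfolding D_def[abs_def] by (intro pf_mult poly_fun_prod D' E)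
    show "poly_fun (a j)" for j unfolding a_def[abs_def] by (intro pf_mult poly_fun_prod A E)
    show "poly_fun (r v j)" for v j
      by (cases "v < n") (auto simp: r_def[abs_def] intro!: pf_mult poly_fun_prod D' E R pf_const)
    have "\<exists>y\<in>vspace n. (\<Prod>v<n. E v y) \<noteq> 0"
      by (rule poly_fun_prod_nonzero) (auto simp: line_closed_vspace vspace_not_empty E)
    then show "\<exists>y\<in>vspace n. D y \<noteq> 0"
      using poly_fun_common_nonzero[OF D'(1) poly_fun_prod[of "{..<n}" E] line_closed_vspace] D'(2) E(1)
      unfolding D_def by (metis mult_eq_0_iff)
    show "r v j = (\<lambda>y. 0)" if "v \<ge> n" for v j using that by (auto simp: r_def)
    fix x assume x: "x \<in> vspace n"
    have "D (Y x) * u x ^ d = (\<Prod>v<n. E v (Y x)) * (D' (Y x) * u x ^ d)" by (simp add: D_def)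
    also have "\<dots> = (\<Sum>j<d. a j (Y x) * u x ^ j)"
      by (simp add: u_rel[OF x] a_def sum_distrib_left mult.assoc)
    finally show "D (Y x) * u x ^ d = (\<Sum>j<d. a j (Y x) * u x ^ j)" .
    show "D (Y x) * x v = (\<Sum>j<d. r v j (Y x) * u x ^ j)" for v
    proof (cases "v < n")
      case True
      have "D (Y x) * x v = D' (Y x) * (\<Prod>w\<in>{..<n} - {v}. E w (Y x)) * (E v (Y x) * x v)"
        using True by (simp add: D_def prod.remove[of "{..<n}" v])
      also have "\<dots> = (\<Sum>j<d. r v j (Y x) * u x ^ j)"
        using True by (simp add: rel[OF x] r_def sum_distrib_left mult.assoc)
      finally show ?thesis .
    next
      case False
      then show ?thesis using x by (simp add: r_def vspace_def)
    qed
  qed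
  show ?thesis by (rule card_generic_fibre_coords)
qed


section \<open>Linear algebra and monomials\<close>

text \<open>Gaussian elimination: \<open>I\<close> indexes the unknowns, and a pivot
  \<open>i0\<close> with nonzero coefficient in equation \<open>j\<close> removes one unknown
  together with that equation.\<close>

lemma underdetermined_system:
  fixes M :: "'i \<Rightarrow> 'j \<Rightarrow> complex"
  assumes "finite J" "finite I" "card J < card I"
  shows "\<exists>v. (\<exists>i\<in>I. v i \<noteq> 0) \<and> (\<forall>j\<in>J. (\<Sum>i\<in>I. v i * M i j) = 0)"
  using assms
proof (induction J arbitrary: I M)
  case empty
  then have "I \<noteq> {}" by auto
  then show ?case by (intro exI[of _ "\<lambda>_. 1"]) auto
next
  case (insert j J)
  show ?case
  proof (cases "\<forall>i\<in>I. M i j = 0")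
    case True
    obtain v where "\<exists>i\<in>I. v i \<noteq> 0" "\<forall>j\<in>J. (\<Sum>i\<in>I. v i * M i j) = 0"
      using insert.IH[of I M] insert.prems insert.hyps by auto
    then show ?thesis using True by (intro exI[of _ v]) auto
  next
    case False
    then obtain i0 where i0: "i0 \<in> I" "M i0 j \<noteq> 0" by auto
    let ?I = "I - {i0}"
    have "card J < card ?I" using insert i0 by (simp add: card_Diff_singleton)
    then obtain v where v: "\<exists>i\<in>?I. v i \<noteq> 0"
      and sol: "\<And>l. l \<in> J \<Longrightarrow> (\<Sum>i\<in>?I. v i * (M i l - M i j / M i0 j * M i0 l)) = 0"
      using insert.IH[of ?I "\<lambda>i l. M i l - M i j / M i0 j * M i0 l"] insert.prems by auto
    \<comment> \<open>The value at the pivot is the one that equation \<open>j\<close>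
      forces.\<close>
    define w where "w = v(i0 := - (\<Sum>i\<in>?I. v i * (M i j / M i0 j)))"
    have sum_w: "(\<Sum>i\<in>I. w i * M i l) = (\<Sum>i\<in>?I. v i * (M i l - M i j / M i0 j * M i0 l))" for l
    proof -
      have "(\<Sum>i\<in>I. w i * M i l) = w i0 * M i0 l + (\<Sum>i\<in>?I. w i * M i l)"
        using i0 insert.prems by (simp add: sum.remove)
      also have "(\<Sum>i\<in>?I. w i * M i l) = (\<Sum>i\<in>?I. v i * M i l)"
        by (rule sum.cong) (auto simp: w_def)
      also have "w i0 * M i0 l = - (\<Sum>i\<in>?I. v i * (M i j / M i0 j) * M i0 l)"
        by (simp add: w_def sum_distrib_right)
      finally show ?thesis by (simp add: sum_subtractf algebra_simps)
    qed
    have "\<exists>i\<in>I. w i \<noteq> 0" using v by (auto simp: w_def)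
    moreover have "(\<Sum>i\<in>I. w i * M i l) = 0" if "l \<in> insert j J" for l
      using that sol i0(2) by (auto simp: sum_w)
    ultimately show ?thesis by blast
  qed
qed

section \<open>Monomials, their independence and their spans\<close>

definition mon :: "nat \<Rightarrow> (nat \<Rightarrow> nat) \<Rightarrow> (nat \<Rightarrow> complex) \<Rightarrow> complex" where
  "mon n e x = (\<Prod>v<n. x v ^ e v)"

lemma poly_fun_mon: "poly_fun (mon n e)"
  unfolding mon_def[abs_def] by (intro poly_fun_prod poly_fun_power pf_var)

lemma mon_add: "mon n (\<lambda>v. e v + e' v) x = mon n e x * mon n e' x"
  by (simp add: mon_def power_add prod.distrib)

text \<open>Read as a polynomial in the last variable, the sum has zero coefficients; the one at
  degree \<open>e n\<close> collects exactly the exponents in \<open>T\<close>, which are still told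
  apart by the remaining variables.\<close>

lemma monomials_independent:
  assumes "finite S"
    and "\<And>e e'. e \<in> S \<Longrightarrow> e' \<in> S \<Longrightarrow> (\<And>v. v < n \<Longrightarrow> e v = e' v) \<Longrightarrow> e = e'"
    and "\<And>x. (\<Sum>e\<in>S. c e * mon n e x) = 0"
    and "e \<in> S"
  shows "c e = 0"
  using assms
proof (induction n arbitrary: S e)
  case 0
  then have "S = {e}" by auto
  then show ?case using "0.prems"(3) by (simp add: mon_def)
next
  case (Suc n)
  define T where "T = {e' \<in> S. e' n = e n}"
  have "(\<Sum>e'\<in>T. c e' * mon n e' x) = 0" for x
  proof -
    define p where "p = (\<Sum>e'\<in>S. monom (c e' * mon n e' x) (e' n))"
    have "poly p t = 0" for t
    proof -
      have "mon (Suc n) e' (x(n := t)) = mon n e' x * t ^ e' n" for e'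
        by (simp add: mon_def)
      then have "poly p t = (\<Sum>e'\<in>S. c e' * mon (Suc n) e' (x(n := t)))"
        by (simp add: p_def poly_sum poly_monom mult.assoc)
      then show ?thesis by (simp add: Suc.prems(3))
    qed
    then have "coeff p (e n) = 0" using poly_all_0_iff_0[of p] by simp
    also have "coeff p (e n) = (\<Sum>e'\<in>S. if e' n = e n then c e' * mon n e' x else 0)"
      by (simp add: p_def coeff_sum)
    also have "\<dots> = (\<Sum>e'\<in>T. c e' * mon n e' x)"
      unfolding T_def by (rule sum.inter_filter[symmetric]) (rule Suc.prems(1))
    finally show ?thesis .
  qed
  moreover have "e1 = e2" if "e1 \<in> T" "e2 \<in> T" "\<And>v. v < n \<Longrightarrow> e1 v = e2 v" for e1 e2
  proof (rule Suc.prems(2))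
    show "e1 \<in> S" "e2 \<in> S" using that(1,2) by (auto simp: T_def)
    show "e1 v = e2 v" if "v < Suc n" for v
      using that \<open>e1 \<in> T\<close> \<open>e2 \<in> T\<close> \<open>\<And>v. v < n \<Longrightarrow> e1 v = e2 v\<close> by (cases "v = n") (auto simp: T_def)
  qed
  ultimately show ?case
    using Suc.IH[of T e] Suc.prems(1,4) by (auto simp: T_def)
qed

definition in_mspan :: "nat \<Rightarrow> (nat \<Rightarrow> nat) set \<Rightarrow> ((nat \<Rightarrow> complex) \<Rightarrow> complex) \<Rightarrow> bool" where
  "in_mspan n S f \<longleftrightarrow> (\<exists>M. \<forall>x\<in>vspace n. f x = (\<Sum>e\<in>S. M e * mon n e x))"

lemma in_mspan_zero: "(\<And>x. x \<in> vspace n \<Longrightarrow> f x = 0) \<Longrightarrow> in_mspan n S f"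
  unfolding in_mspan_def by (rule exI[of _ "\<lambda>_. 0"]) simp

lemma in_mspan_add:
  assumes "in_mspan n S f" "in_mspan n S g"
  shows "in_mspan n S (\<lambda>x. f x + g x)"
proof -
  obtain M where "\<forall>x\<in>vspace n. f x = (\<Sum>e\<in>S. M e * mon n e x)"
    using assms(1) unfolding in_mspan_def by auto
  moreover obtain M' where "\<forall>x\<in>vspace n. g x = (\<Sum>e\<in>S. M' e * mon n e x)"
    using assms(2) unfolding in_mspan_def by auto
  ultimately have "\<forall>x\<in>vspace n. f x + g x = (\<Sum>e\<in>S. (M e + M' e) * mon n e x)"
    by (simp add: sum.distrib algebra_simps)
  then show ?thesis unfolding in_mspan_def by (intro exI[of _ "\<lambda>e. M e + M' e"])
qed

lemma in_mspan_sum: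
  "(\<And>i. i \<in> A \<Longrightarrow> in_mspan n S (f i)) \<Longrightarrow> in_mspan n S (\<lambda>x. \<Sum>i\<in>A. f i x)"
  by (induction A rule: infinite_finite_induct) (auto intro: in_mspan_zero in_mspan_add)

lemma in_mspan_mon:
  assumes "finite S" "e \<in> S"
  shows "in_mspan n S (\<lambda>x. c * mon n e x)"
  unfolding in_mspan_def
  by (rule exI[of _ "\<lambda>e'. if e' = e then c else 0"])
     (use assms in \<open>simp add: if_distrib[of "\<lambda>z. z * _"] sum.delta cong: if_cong\<close>)

lemma in_mspan_mult:
  assumes "in_mspan n S f" "in_mspan n S' g" "finite T"
    and "\<And>e e'. e \<in> S \<Longrightarrow> e' \<in> S' \<Longrightarrow> (\<lambda>v. e v + e' v) \<in> T"
  shows "in_mspan n T (\<lambda>x. f x * g x)"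
proof -
  obtain M where M: "\<forall>x\<in>vspace n. f x = (\<Sum>e\<in>S. M e * mon n e x)"
    using assms(1) unfolding in_mspan_def by auto
  obtain M' where M': "\<forall>x\<in>vspace n. g x = (\<Sum>e\<in>S'. M' e * mon n e x)"
    using assms(2) unfolding in_mspan_def by auto
  have "in_mspan n T (\<lambda>x. \<Sum>e\<in>S. \<Sum>e'\<in>S'. (M e * M' e') * mon n (\<lambda>v. e v + e' v) x)"
    by (intro in_mspan_sum in_mspan_mon assms)
  moreover have "f x * g x = (\<Sum>e\<in>S. \<Sum>e'\<in>S'. (M e * M' e') * mon n (\<lambda>v. e v + e' v) x)"
    if "x \<in> vspace n" for x
    using that M M' by (simp add: sum_product mon_add mult.assoc mult.left_commute)
  ultimately show ?thesis unfolding in_mspan_def by auto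
qed

lemma in_mspan_mono:
  assumes "in_mspan n S f" "S \<subseteq> T" "finite T"
  shows "in_mspan n T f"
proof -
  obtain M where M: "\<forall>x\<in>vspace n. f x = (\<Sum>e\<in>S. M e * mon n e x)"
    using assms(1) unfolding in_mspan_def by auto
  have "in_mspan n T (\<lambda>x. \<Sum>e\<in>S. M e * mon n e x)"
    by (intro in_mspan_sum in_mspan_mon) (use assms in auto)
  with M show ?thesis unfolding in_mspan_def by auto
qed

section \<open>The parametrised moment map\<close>

text \<open>A point of \<open>vspace (3 * k)\<close> lists the weights, the variances and the means; the moment map
  keeps the first two blocks and replaces the means by the first \<open>k\<close> moments.\<close>

definition moment_map :: "nat \<Rightarrow> (nat \<Rightarrow> complex) \<Rightarrow> nat \<Rightarrow> complex" where
  "moment_map k x v = (if v < 2 * k then x v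
     else if v < 3 * k then \<Sum>l<k. x l * Mom (v - 2 * k + 1) (x (2 * k + l)) (x (k + l)) else 0)"

lemma poly_fun_Mom:
  assumes "poly_fun f" "poly_fun g"
  shows "poly_fun (\<lambda>x. Mom i (f x) (g x))"
proof (induction i rule: induct_nat_012)
  case (ge2 n)
  then show ?case using assms by (auto intro!: pf_add pf_mult pf_const)
qed (auto intro: pf_const assms)

lemma poly_fun_moment_map: "poly_fun (\<lambda>x. moment_map k x v)"
  unfolding moment_map_def
  by (cases "v < 2 * k"; cases "v < 3 * k")
     (auto intro!: pf_var pf_const poly_fun_sum pf_mult poly_fun_Mom)

lemma moment_map_vspace: "moment_map k x \<in> vspace (3 * k)"
  by (simp add: moment_map_def vspace_def)

section \<open>Dependence over the moment polynomials by counting monomials\<close>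

definition exps :: "nat \<Rightarrow> nat \<Rightarrow> nat \<Rightarrow> (nat \<Rightarrow> nat) set" where
  "exps k A N = {e. (\<forall>v\<ge>3 * k. e v = 0) \<and> (\<Sum>v<2 * k. e v) \<le> A \<and> (\<Sum>l<k. e (2 * k + l)) \<le> N}"

text \<open>The moment of order l + 1 has degree at most l + 1 in the means, whence the weight
  \<open>Suc l\<close>: N bounds the mean degree after the moments are substituted.\<close>

definition wexps :: "nat \<Rightarrow> nat \<Rightarrow> nat \<Rightarrow> (nat \<Rightarrow> nat) set" where
  "wexps k A N = {e. (\<forall>v\<ge>3 * k. e v = 0) \<and> (\<Sum>v<2 * k. e v) \<le> A \<and> (\<Sum>l<k. Suc l * e (2 * k + l)) \<le> N}"

lemma exps_bound:
  assumes "e \<in> exps k A N"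
  shows "e v \<le> max A N"
proof -
  consider "v < 2 * k" | "2 * k \<le> v" "v < 3 * k" | "v \<ge> 3 * k" by linarith
  then show ?thesis
  proof cases
    case 1
    then have "e v \<le> (\<Sum>v<2 * k. e v)" by (intro member_le_sum) auto
    then show ?thesis using assms by (auto simp: exps_def)
  next
    case 2
    then have "e (2 * k + (v - 2 * k)) \<le> (\<Sum>l<k. e (2 * k + l))"
      by (intro member_le_sum[of "v - 2 * k" _ "\<lambda>l. e (2 * k + l)"]) auto
    then show ?thesis using assms 2 by (auto simp: exps_def)
  next
    case 3
    then show ?thesis using assms by (simp add: exps_def)
  qed
qed

lemma restrict_exps_inj: "inj_on (\<lambda>e. restrict e {..<3 * k}) (exps k A N)"
proof (rule inj_onI)
  fix e e' assume e: "e \<in> exps k A N" "e' \<in> exps k A N" "restrict e {..<3 * k} = restrict e' {..<3 * k}"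
  show "e = e'"
  proof
    fix v
    show "e v = e' v"
      using e(1,2) fun_cong[OF e(3), of v] by (cases "v < 3 * k") (auto simp: exps_def)
  qed
qed

lemma restrict_exps_subset:
  "(\<lambda>e. restrict e {..<3 * k}) ` exps k A N \<subseteq> {..<3 * k} \<rightarrow>\<^sub>E {..max A N}"
  by (rule image_subsetI, rule PiE_I) (simp_all add: exps_bound)

lemma finite_exps: "finite (exps k A N)"
  by (rule inj_on_finite[OF restrict_exps_inj restrict_exps_subset]) (simp add: finite_PiE)

lemma card_exps_le: "card (exps k A N) \<le> Suc (max A N) ^ (3 * k)"
  using card_inj_on_le[OF restrict_exps_inj restrict_exps_subset] by (simp add: finite_PiE card_PiE)

lemma wexps_subset: "wexps k A N \<subseteq> exps k A N"
proof
  fix e assume e: "e \<in> wexps k A N"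
  have "(\<Sum>l<k. e (2 * k + l)) \<le> (\<Sum>l<k. Suc l * e (2 * k + l))"
    by (rule sum_mono) simp
  with e show "e \<in> exps k A N" by (auto simp: exps_def wexps_def)
qed

lemma finite_wexps: "finite (wexps k A N)"
  by (rule finite_subset[OF wexps_subset finite_exps])

text \<open>Dividing the \<open>l\<close>-th exponent by \<open>l + 1\<close> turns the plain grading into the weighted one;
  the remainders account for the factor \<open>k!\<close>.\<close>
lemma card_exps_le_wexps: "card (exps k A N) \<le> fact k * card (wexps k A N)"
proof -
  define quot where "quot e v = (if v < 2 * k then e v else e v div Suc (v - 2 * k))" for e :: "nat \<Rightarrow> nat" and v
  define rem where "rem e = (\<lambda>l\<in>{..<k}. e (2 * k + l) mod Suc l)" for e :: "nat \<Rightarrow> nat"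
  let ?R = "\<Pi>\<^sub>E l\<in>{..<k}. {..<Suc l}"
  have "inj_on (\<lambda>e. (quot e, rem e)) (exps k A N)"
  proof (rule inj_onI)
    fix e e' assume e: "e \<in> exps k A N" "e' \<in> exps k A N" "(quot e, rem e) = (quot e', rem e')"
    show "e = e'"
    proof
      fix v
      have q: "quot e v = quot e' v" and r: "rem e (v - 2 * k) = rem e' (v - 2 * k)"
        using e(3) by auto
      consider "v < 2 * k" | "2 * k \<le> v" "v < 3 * k" | "v \<ge> 3 * k" by linarith
      then show "e v = e' v"
      proof cases
        case 2
        then have "e v div Suc (v - 2 * k) = e' v div Suc (v - 2 * k)"
          "e v mod Suc (v - 2 * k) = e' v mod Suc (v - 2 * k)"
          using q r by (auto simp: quot_def rem_def split: if_splits)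
        then show ?thesis by (metis div_mult_mod_eq)
      qed (use q e(1,2) in \<open>auto simp: quot_def exps_def\<close>)
    qed
  qed
  moreover have "(\<lambda>e. (quot e, rem e)) ` exps k A N \<subseteq> wexps k A N \<times> ?R"
  proof (clarify, rule conjI)
    fix e assume e: "e \<in> exps k A N"
    have "(\<Sum>l<k. Suc l * quot e (2 * k + l)) \<le> (\<Sum>l<k. e (2 * k + l))"
      by (rule sum_mono) (simp add: quot_def del: mult_Suc)
    then show "quot e \<in> wexps k A N"
      using e by (auto simp: exps_def wexps_def quot_def simp del: mult_Suc)
    show "rem e \<in> ?R" by (auto simp: rem_def)
  qed
  moreover have "finite (wexps k A N \<times> ?R)"
    by (simp add: finite_wexps finite_PiE)
  ultimately have "card (exps k A N) \<le> card (wexps k A N \<times> ?R)"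
    by (rule card_inj_on_le)
  also have "\<dots> = card ?R * card (wexps k A N)"
    by (simp add: card_cartesian_product mult.commute)
  also have "card ?R = fact k"
    by (simp add: card_PiE fact_prod_Suc lessThan_atLeast0)
  finally show ?thesis .
qed

section \<open>Degree bounds, separately in the parameters and in the means\<close>

definition of_bidegree :: "nat \<Rightarrow> nat \<Rightarrow> nat \<Rightarrow> ((nat \<Rightarrow> complex) \<Rightarrow> complex) \<Rightarrow> bool" where
  "of_bidegree k A N f \<longleftrightarrow> in_mspan (3 * k) (exps k A N) f"

lemma bidegree_mono:
  assumes "of_bidegree k A N f" "A \<le> A'" "N \<le> N'"
  shows "of_bidegree k A' N' f"
proof -
  have "exps k A N \<subseteq> exps k A' N'" using assms(2,3) by (auto simp: exps_def)
  then show ?thesis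
    using assms(1) in_mspan_mono[OF _ _ finite_exps] unfolding of_bidegree_def by blast
qed

lemma bidegree_mult:
  assumes "of_bidegree k A N f" "of_bidegree k A' N' g"
  shows "of_bidegree k (A + A') (N + N') (\<lambda>x. f x * g x)"
  using assms unfolding of_bidegree_def
  by (rule in_mspan_mult[OF _ _ finite_exps]) (auto simp: exps_def sum.distrib intro: add_mono)

lemma bidegree_const: "of_bidegree k 0 0 (\<lambda>x. c)"
  using in_mspan_mon[OF finite_exps, of "\<lambda>_. 0" k 0 0 "3 * k" c]
  by (simp add: of_bidegree_def exps_def mon_def)

lemma bidegree_cmult: "of_bidegree k A N f \<Longrightarrow> of_bidegree k A N (\<lambda>x. c * f x)"
  using bidegree_mult[OF bidegree_const] by fastforce

lemma bidegree_add:
  "of_bidegree k A N f \<Longrightarrow> of_bidegree k A N g \<Longrightarrow> of_bidegree k A N (\<lambda>x. f x + g x)"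
  unfolding of_bidegree_def by (rule in_mspan_add)

lemma bidegree_sum:
  "(\<And>i. i \<in> T \<Longrightarrow> of_bidegree k A N (f i)) \<Longrightarrow> of_bidegree k A N (\<lambda>x. \<Sum>i\<in>T. f i x)"
  unfolding of_bidegree_def by (rule in_mspan_sum)

lemma bidegree_prod:
  "(\<And>i. i \<in> T \<Longrightarrow> of_bidegree k (A i) (N i) (f i)) \<Longrightarrow>
    of_bidegree k (\<Sum>i\<in>T. A i) (\<Sum>i\<in>T. N i) (\<lambda>x. \<Prod>i\<in>T. f i x)"
  by (induction T rule: infinite_finite_induct) (auto intro: bidegree_const bidegree_mult)

lemma bidegree_power: "of_bidegree k A N f \<Longrightarrow> of_bidegree k (i * A) (i * N) (\<lambda>x. f x ^ i)"
  by (induction i) (auto intro: bidegree_const bidegree_mult)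

lemma mon_single: "v < n \<Longrightarrow> mon n (\<lambda>w. if w = v then 1 else 0) x = x v"
  by (simp add: mon_def if_distrib[of "\<lambda>i. _ ^ i"] prod.delta cong: if_cong)

lemma bidegree_param: "v < 2 * k \<Longrightarrow> of_bidegree k 1 0 (\<lambda>x. x v)"
  using in_mspan_mon[OF finite_exps, of "\<lambda>w. if w = v then 1 else 0" k 1 0 "3 * k" 1]
  by (simp add: of_bidegree_def exps_def mon_single sum.delta)

lemma bidegree_mean: "l < k \<Longrightarrow> of_bidegree k 0 1 (\<lambda>x. x (2 * k + l))"
  using in_mspan_mon[OF finite_exps, of "\<lambda>w. if w = 2 * k + l then 1 else 0" k 0 1 "3 * k" 1]
  by (simp add: of_bidegree_def exps_def mon_single sum.delta)

lemma bidegree_poly_fun: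
  assumes "poly_fun g"
  shows "\<exists>G. of_bidegree k G G g"
  using assms
proof induction
  case (pf_const c)
  then show ?case using bidegree_const by blast
next
  case (pf_var v)
  consider "v < 2 * k" | "2 * k \<le> v" "v < 3 * k" | "v \<ge> 3 * k" by linarith
  then show ?case
  proof cases
    case 1
    then show ?thesis using bidegree_mono[OF bidegree_param[of v k], of 1 1] by auto
  next
    case 2
    then have "v - 2 * k < k" by linarith
    then show ?thesis using 2 bidegree_mono[OF bidegree_mean[of "v - 2 * k" k], of 1 1] by auto
  next
    case 3
    then have "of_bidegree k 0 0 (\<lambda>x. x v)"
      unfolding of_bidegree_def by (intro in_mspan_zero) (simp add: vspace_def)
    then show ?thesis by blast
  qed
next
  case (pf_add p q)
  then obtain G H where "of_bidegree k G G p" "of_bidegree k H H q" by auto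
  then have "of_bidegree k (max G H) (max G H) (\<lambda>x. p x + q x)"
    by (intro bidegree_add) (auto elim: bidegree_mono)
  then show ?case by blast
next
  case (pf_mult p q)
  then show ?case using bidegree_mult by blast
qed

lemma bidegree_Mom:
  assumes "l < k"
  shows "of_bidegree k i i (\<lambda>x. Mom i (x (2 * k + l)) (x (k + l)))"
proof (induction i rule: induct_nat_012)
  case 0
  then show ?case by (simp add: bidegree_const)
next
  case 1
  then show ?case using bidegree_mono[OF bidegree_mean[OF assms]] by simp
next
  case (ge2 n)
  have "of_bidegree k (0 + Suc n) (1 + Suc n) (\<lambda>x. x (2 * k + l) * Mom (Suc n) (x (2 * k + l)) (x (k + l)))"
    by (intro bidegree_mult bidegree_mean assms ge2)
  moreover have "of_bidegree k (1 + n) (0 + n) (\<lambda>x. of_nat (Suc n) * x (k + l) * Mom n (x (2 * k + l)) (x (k + l)))"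
    by (intro bidegree_mult bidegree_cmult bidegree_param ge2) (use assms in simp)
  ultimately show ?case
    by (auto intro!: bidegree_add elim!: bidegree_mono simp del: of_nat_Suc)
qed

text \<open>The parameter degree is rounded up to twice the weight of the moment, so that a monomial
  of weight N in the moments costs at most 2 N.\<close>

lemma bidegree_moment:
  assumes "l < k"
  shows "of_bidegree k (2 * Suc l) (Suc l) (\<lambda>x. moment_map k x (2 * k + l))"
proof -
  have "of_bidegree k (1 + Suc l) (0 + Suc l) (\<lambda>x. \<Sum>i<k. x i * Mom (Suc l) (x (2 * k + i)) (x (k + i)))"
    by (intro bidegree_sum bidegree_mult bidegree_param bidegree_Mom) auto
  then show ?thesis
    using assms by (auto simp: moment_map_def elim: bidegree_mono)
qed

lemma bidegree_mon_moment_map: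
  assumes "e \<in> wexps k A N"
  shows "of_bidegree k (A + 2 * N) N (\<lambda>x. mon (3 * k) e (moment_map k x))"
proof -
  have split: "mon (3 * k) e y = (\<Prod>v<2 * k. y v ^ e v) * (\<Prod>l<k. y (2 * k + l) ^ e (2 * k + l))" for y
  proof -
    have "mon (3 * k) e y = (\<Prod>v\<in>{..<2 * k} \<union> {2 * k..<2 * k + k}. y v ^ e v)"
      unfolding mon_def by (rule prod.cong) auto
    also have "\<dots> = (\<Prod>v<2 * k. y v ^ e v) * (\<Prod>v\<in>{2 * k..<2 * k + k}. y v ^ e v)"
      by (rule prod.union_disjoint) auto
    also have "(\<Prod>v\<in>{2 * k..<2 * k + k}. y v ^ e v) = (\<Prod>l<k. y (2 * k + l) ^ e (2 * k + l))"
      using prod.shift_bounds_nat_ivl[of "\<lambda>v. y v ^ e v" 0 "2 * k" k]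
      by (simp add: lessThan_atLeast0 add.commute)
    finally show ?thesis .
  qed
  have "of_bidegree k (\<Sum>v<2 * k. e v * 1) (\<Sum>v<2 * k. e v * 0) (\<lambda>x. \<Prod>v<2 * k. moment_map k x v ^ e v)"
    by (intro bidegree_prod bidegree_power) (use bidegree_param in \<open>simp add: moment_map_def\<close>)
  moreover have "of_bidegree k (\<Sum>l<k. e (2 * k + l) * (2 * Suc l)) (\<Sum>l<k. e (2 * k + l) * Suc l)
      (\<lambda>x. \<Prod>l<k. moment_map k x (2 * k + l) ^ e (2 * k + l))"
    by (intro bidegree_prod bidegree_power bidegree_moment) simp
  ultimately have *: "of_bidegree k ((\<Sum>v<2 * k. e v * 1) + (\<Sum>l<k. e (2 * k + l) * (2 * Suc l)))
      ((\<Sum>v<2 * k. e v * 0) + (\<Sum>l<k. e (2 * k + l) * Suc l)) (\<lambda>x. mon (3 * k) e (moment_map k x))"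
    unfolding split by (rule bidegree_mult)
  have "(\<Sum>l<k. e (2 * k + l) * (2 * Suc l)) = 2 * (\<Sum>l<k. Suc l * e (2 * k + l))"
    by (simp only: sum_distrib_left mult_ac)
  moreover have "(\<Sum>l<k. e (2 * k + l) * Suc l) = (\<Sum>l<k. Suc l * e (2 * k + l))"
    by (simp only: mult_ac)
  ultimately show ?thesis
    using assms by (intro bidegree_mono[OF *]) (auto simp: wexps_def)
qed

section \<open>Polynomial against exponential growth\<close>

lemma exp_beats_polynomial:
  fixes c :: real
  assumes "c > 1"
  shows "\<exists>r. real (Suc ((r * G)\<^sup>2)) ^ m < c ^ r"
proof -
  \<comment> \<open>Chosen so that \<open>K * (ln c * real r) ^ (2 * m)\<close> equals
    \<open>((real G ^ 2 + 1) * real r ^ 2) ^ m\<close>, which dominates the left-hand side of the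
    goal once \<open>r \<ge> 1\<close>.\<close>
  define K where "K = (real G ^ 2 + 1) ^ m / ln c ^ (2 * m)"
  have lnc: "ln c > 0" using assms by simp
  have "((\<lambda>x::real. x ^ (2 * m) / exp x) \<longlongrightarrow> 0) at_top"
    by (rule tendsto_power_div_exp_0)
  moreover have "filterlim (\<lambda>r. ln c * real r) at_top sequentially"
    by (rule filterlim_tendsto_pos_mult_at_top[OF tendsto_const lnc filterlim_real_sequentially])
  ultimately have "(\<lambda>r. (ln c * real r) ^ (2 * m) / exp (ln c * real r)) \<longlonglongrightarrow> 0"
    by (rule filterlim_compose)
  then have "(\<lambda>r. K * ((ln c * real r) ^ (2 * m) / exp (ln c * real r))) \<longlonglongrightarrow> K * 0"
    by (intro tendsto_intros)
  then have "eventually (\<lambda>r. K * ((ln c * real r) ^ (2 * m) / exp (ln c * real r)) < 1) sequentially"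
    by (intro order_tendstoD(2)[of _ 0]) auto
  then have "eventually (\<lambda>r. K * ((ln c * real r) ^ (2 * m) / exp (ln c * real r)) < 1 \<and> r \<ge> 1) sequentially"
    using eventually_ge_at_top by (rule eventually_conj)
  then obtain r where r: "K * ((ln c * real r) ^ (2 * m) / exp (ln c * real r)) < 1" "r \<ge> 1"
    unfolding eventually_sequentially by blast
  have "K * (ln c * real r) ^ (2 * m) < exp (ln c * real r)"
    using r(1) by (simp add: field_simps)
  also have "exp (ln c * real r) = c ^ r"
    using assms by (simp add: exp_of_nat2_mult)
  also have "K * (ln c * real r) ^ (2 * m) = ((real G ^ 2 + 1) * real r ^ 2) ^ m"
    using lnc by (simp add: K_def power_mult_distrib power_mult)
  finally have "((real G ^ 2 + 1) * real r ^ 2) ^ m < c ^ r" .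
  moreover have "real (Suc ((r * G)\<^sup>2)) \<le> (real G ^ 2 + 1) * real r ^ 2"
    using r(2) by (simp add: algebra_simps power_mult_distrib)
  then have "real (Suc ((r * G)\<^sup>2)) ^ m \<le> ((real G ^ 2 + 1) * real r ^ 2) ^ m"
    by (rule power_mono) simp
  ultimately show ?thesis by (intro exI[of _ r]) linarith
qed

text \<open>Otherwise each step of length \<open>G\<close> multiplies \<open>f\<close> by at least
  (d + 1) / d, and \<open>f\<close> grows exponentially along the multiples of
  \<open>G\<close>.\<close>

lemma slow_growth:
  fixes f :: "nat \<Rightarrow> nat"
  assumes "f 0 > 0" "\<And>N. f N \<le> Suc (N\<^sup>2) ^ m" "d > 0"
  shows "\<exists>N. d * f (N + G) < Suc d * f N"
proof (rule ccontr)
  assume "\<not> ?thesis"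
  then have step: "Suc d * f N \<le> d * f (N + G)" for N by (simp add: not_less)
  define c where "c = real (Suc d) / real d"
  have c: "c > 1" using assms(3) by (simp add: c_def)
  have "c ^ r \<le> f (r * G)" for r
  proof (induction r)
    case 0
    then show ?case using assms(1) by simp
  next
    case (Suc r)
    have "c ^ Suc r \<le> c * f (r * G)" using Suc c by simp
    also have "\<dots> = real (Suc d * f (r * G)) / d" by (simp add: c_def algebra_simps)
    also have "\<dots> \<le> real (d * f (r * G + G)) / d"
      by (rule divide_right_mono) (use step[of "r * G"] in \<open>simp_all only: of_nat_le_iff of_nat_0_le_iff\<close>)
    also have "\<dots> = f (Suc r * G)" using assms(3) by (simp add: add.commute)
    finally show ?case .
  qed
  moreover obtain r where "real (Suc ((r * G)\<^sup>2)) ^ m < c ^ r"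
    using exp_beats_polynomial[OF c] by blast
  moreover have "real (f (r * G)) \<le> real (Suc ((r * G)\<^sup>2)) ^ m"
    using assms(2)[of "r * G"] by (metis of_nat_le_iff of_nat_power)
  ultimately show False by (meson less_le_trans not_less order_trans)
qed

lemma dependent_over_moments:
  fixes g :: "nat \<Rightarrow> (nat \<Rightarrow> complex) \<Rightarrow> complex"
  assumes g: "\<And>j. poly_fun (g j)"
  shows "\<exists>c. (\<forall>j. poly_fun (c j)) \<and> (\<exists>j\<le>fact k. \<exists>y\<in>vspace (3 * k). c j y \<noteq> 0) \<and>
    (\<forall>x\<in>vspace (3 * k). (\<Sum>j\<le>fact k. c j (moment_map k x) * g j x) = 0)"
proof -
  define d :: nat where "d = fact k"
  have "\<exists>G. of_bidegree k G G (g j)" for j using bidegree_poly_fun[OF g] by blast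
  then obtain G0 :: "nat \<Rightarrow> nat" where G0: "\<And>j. of_bidegree k (G0 j) (G0 j) (g j)" by metis
  \<comment> \<open>The \<open>Suc\<close> gives \<open>G \<ge> 1\<close>, on which the later
    inequality \<open>N\<^sup>2 + 2 * N + G \<le> (N + G)\<^sup>2\<close> relies.\<close>
  define G where "G = Suc (\<Sum>j\<le>d. G0 j)"
  have G: "of_bidegree k G G (g j)" if "j \<le> d" for j
  proof -
    have "G0 j \<le> G" unfolding G_def using that by (intro le_SucI member_le_sum) auto
    then show ?thesis using bidegree_mono[OF G0] by blast
  qed
  \<comment> \<open>Substituting the moments raises the parameter degree by up to 2 N. With the
    bound N^2 this overhead, and that of the \<open>g j\<close>, fit into the step from N to N +
    G.\<close>
  define I where "I N = wexps k (N\<^sup>2) N" for N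
  have "\<exists>N. d * card (I (N + G)) < Suc d * card (I N)"
  proof (rule slow_growth)
    have "(\<lambda>_. 0) \<in> I 0" by (simp add: I_def wexps_def)
    then show "card (I 0) > 0" using finite_wexps by (auto simp: I_def card_gt_0_iff)
    show "card (I N) \<le> Suc (N\<^sup>2) ^ (3 * k)" for N
    proof -
      have "N \<le> N\<^sup>2" by (simp add: power2_eq_square)
      then have "max (N\<^sup>2) N = N\<^sup>2" by simp
      then show ?thesis
        using card_mono[OF finite_exps wexps_subset, of k "N\<^sup>2" N] card_exps_le[of k "N\<^sup>2" N]
        by (simp add: I_def)
    qed
    show "d > 0" by (simp add: d_def)
  qed
  then obtain N where N: "d * card (I (N + G)) < Suc d * card (I N)" by blast
  define J where "J = exps k ((N + G)\<^sup>2) (N + G)"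
  \<comment> \<open>Passing from plain to weighted degree loses the factor d = k!; the d + 1
    functions \<open>g j\<close> more than make up for it. So there are more products of moment
    monomials with some \<open>g j\<close> than monomials needed to expand them.\<close>
  have cardJ: "card J < card ({..d} \<times> I N)"
    using card_exps_le_wexps[of k "(N + G)\<^sup>2" "N + G"] N
    by (simp add: J_def I_def d_def card_cartesian_product)
  have "in_mspan (3 * k) J (\<lambda>x. mon (3 * k) e (moment_map k x) * g j x)" if "j \<le> d" "e \<in> I N" for j e
  proof -
    have "of_bidegree k (N\<^sup>2 + 2 * N + G) (N + G) (\<lambda>x. mon (3 * k) e (moment_map k x) * g j x)"
      using that by (intro bidegree_mult G bidegree_mon_moment_map) (auto simp: I_def)
    moreover have "N\<^sup>2 + 2 * N + G \<le> (N + G)\<^sup>2"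
      by (simp add: power2_eq_square algebra_simps G_def)
    ultimately show ?thesis
      using bidegree_mono unfolding J_def of_bidegree_def[symmetric] by blast
  qed
  then have "\<exists>M. \<forall>x\<in>vspace (3 * k). mon (3 * k) e (moment_map k x) * g j x = (\<Sum>e'\<in>J. M e' * mon (3 * k) e' x)"
    if "j \<le> d" "e \<in> I N" for j e
    using that unfolding in_mspan_def by blast
  then obtain M where M: "\<And>j e x. j \<le> d \<Longrightarrow> e \<in> I N \<Longrightarrow> x \<in> vspace (3 * k) \<Longrightarrow>
      mon (3 * k) e (moment_map k x) * g j x = (\<Sum>e'\<in>J. M j e e' * mon (3 * k) e' x)"
    by metis
  have finJ: "finite J" "finite (I N)" by (simp_all add: J_def I_def finite_exps finite_wexps)
  obtain w where w: "\<exists>i\<in>{..d} \<times> I N. w i \<noteq> 0"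
    and w0: "\<And>e'. e' \<in> J \<Longrightarrow> (\<Sum>i\<in>{..d} \<times> I N. w i * M (fst i) (snd i) e') = 0"
    using underdetermined_system[OF finJ(1) _ cardJ, of "\<lambda>i. M (fst i) (snd i)"] finJ(2) by auto
  define c where "c j y = (\<Sum>e\<in>I N. w (j, e) * mon (3 * k) e y)" for j y
  have "poly_fun (c j)" for j
    unfolding c_def[abs_def] by (intro poly_fun_sum pf_mult pf_const poly_fun_mon)
  moreover have "\<exists>j\<le>d. \<exists>y\<in>vspace (3 * k). c j y \<noteq> 0"
  proof (rule ccontr)
    assume neg: "\<not> ?thesis"
    obtain j e where je: "j \<le> d" "e \<in> I N" "w (j, e) \<noteq> 0" using w by auto
    have "(\<Sum>e\<in>I N. w (j, e) * mon (3 * k) e y) = 0" for y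
    proof -
      let ?y = "\<lambda>v. if v < 3 * k then y v else 0"
      have "mon (3 * k) e y = mon (3 * k) e ?y" for e by (simp add: mon_def)
      moreover have "?y \<in> vspace (3 * k)" by (simp add: vspace_def)
      then have "c j ?y = 0" using neg je(1) by blast
      ultimately show ?thesis by (simp add: c_def)
    qed
    moreover have "e1 = e2" if "e1 \<in> I N" "e2 \<in> I N" "\<And>v. v < 3 * k \<Longrightarrow> e1 v = e2 v" for e1 e2
    proof
      fix v
      show "e1 v = e2 v" using that by (cases "v < 3 * k") (auto simp: I_def wexps_def)
    qed
    ultimately show False
      using monomials_independent[OF finJ(2), of "3 * k" "\<lambda>e. w (j, e)" e] je(2,3) by blast
  qed
  moreover have "(\<Sum>j\<le>d. c j (moment_map k x) * g j x) = 0" if x: "x \<in> vspace (3 * k)" for x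
  proof -
    have "(\<Sum>j\<le>d. c j (moment_map k x) * g j x)
        = (\<Sum>j\<le>d. \<Sum>e\<in>I N. w (j, e) * (mon (3 * k) e (moment_map k x) * g j x))"
      by (simp add: c_def sum_distrib_right mult.assoc)
    also have "\<dots> = (\<Sum>i\<in>{..d} \<times> I N. w i * (\<Sum>e'\<in>J. M (fst i) (snd i) e' * mon (3 * k) e' x))"
      by (simp add: sum.cartesian_product M x case_prod_beta)
    also have "\<dots> = (\<Sum>e'\<in>J. (\<Sum>i\<in>{..d} \<times> I N. w i * M (fst i) (snd i) e') * mon (3 * k) e' x)"
      by (simp add: sum_distrib_left sum_distrib_right mult.assoc sum.swap[of _ J])
    also have "\<dots> = 0" by (simp add: w0)
    finally show ?thesis .
  qed
  ultimately show ?thesis unfolding d_def by blast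
qed


section \<open>Power sums attain all values\<close>

text \<open>Newton's identities as a single identity of power series, obtained from the logarithmic
  derivative of the product.\<close>

lemma fps_newton:
  fixes \<mu> :: "nat \<Rightarrow> complex"
  shows "fps_X * fps_deriv (\<Prod>l<k. 1 - fps_const (\<mu> l) * fps_X)
    = - ((\<Prod>l<k. 1 - fps_const (\<mu> l) * fps_X) * Abs_fps (\<lambda>i. if i = 0 then 0 else \<Sum>l<k. \<mu> l ^ i))"
proof (induction k)
  case 0
  have "Abs_fps (\<lambda>i. if i = 0 then 0 else \<Sum>l<0. \<mu> l ^ i) = 0"
    by (rule fps_ext) simp
  then show ?case by simp
next
  case (Suc k)
  define F where "F = (\<Prod>l<k. 1 - fps_const (\<mu> l) * fps_X)"
  define S where "S = Abs_fps (\<lambda>i. if i = 0 then 0 else \<Sum>l<k. \<mu> l ^ i)"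
  define L where "L = 1 - fps_const (\<mu> k) * fps_X"
  define G where "G = Abs_fps (\<lambda>i. if i = 0 then 0 else \<mu> k ^ i)"
  have IH: "fps_X * fps_deriv F = - (F * S)" using Suc by (simp add: F_def S_def)
  have LG: "L * G = fps_const (\<mu> k) * fps_X"
  proof (rule fps_ext)
    fix n
    show "fps_nth (L * G) n = fps_nth (fps_const (\<mu> k) * fps_X) n"
      by (cases n; cases "n - 1") (auto simp: L_def G_def left_diff_distrib mult.assoc)
  qed
  have "fps_deriv L = - fps_const (\<mu> k)" by (simp add: L_def)
  then have XdL: "fps_X * fps_deriv L = - (L * G)"
    unfolding LG by (simp only: mult_minus_right mult.commute)
  have SG: "Abs_fps (\<lambda>i. if i = 0 then 0 else \<Sum>l<Suc k. \<mu> l ^ i) = S + G"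
    by (rule fps_ext) (simp add: S_def G_def)
  have "fps_X * fps_deriv (F * L) = (fps_X * fps_deriv F) * L + F * (fps_X * fps_deriv L)"
    by (simp add: algebra_simps)
  also have "\<dots> = - (F * S) * L - F * (L * G)"
    by (simp add: IH XdL)
  also have "\<dots> = - ((F * L) * (S + G))" by (simp add: algebra_simps)
  finally show ?case by (simp only: SG prod.lessThan_Suc F_def[symmetric] L_def[symmetric])
qed

text \<open>Newton's recursion solved for the signed elementary symmetric functions of unknown
  numbers whose power sums are prescribed as \<open>s\<close>.\<close>

fun newton_coeff :: "(nat \<Rightarrow> complex) \<Rightarrow> nat \<Rightarrow> complex" where
  "newton_coeff s n = (if n = 0 then 1 else - (\<Sum>i<n. newton_coeff s i * s (n - i)) / of_nat n)"

declare newton_coeff.simps [simp del]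

lemma power_sums_surjective:
  fixes s :: "nat \<Rightarrow> complex"
  shows "\<exists>\<mu>. \<forall>n\<in>{1..k}. (\<Sum>l<k. \<mu> l ^ n) = s n"
proof -
  define f where "f = newton_coeff s"
  have f0: "f 0 = 1" by (simp add: f_def newton_coeff.simps)
  have f_rec: "of_nat n * f n = - (\<Sum>i<n. f i * s (n - i))" if "n > 0" for n
    using that by (simp add: f_def newton_coeff.simps[of s n])
  \<comment> \<open>The monic polynomial whose roots should have these power sums; its reflection is
    the product \<open>F\<close> of the factors 1 - mu_l X.\<close>
  define q where "q = (\<Sum>n\<le>k. monom (f n) (k - n))"
  have coeff_q: "coeff q (k - n) = f n" if "n \<le> k" for n
  proof -
    have "coeff q (k - n) = (\<Sum>m\<le>k. if m = n then f m else 0)"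
      unfolding q_def coeff_sum by (rule sum.cong) (use that in auto)
    then show ?thesis using that by simp
  qed
  have "degree q \<le> k"
    unfolding q_def by (rule degree_sum_le) (auto intro: order_trans[OF degree_monom_le])
  moreover have lead: "coeff q k = 1" using coeff_q[of 0] f0 by simp
  ultimately have deg: "degree q = k" by (intro antisym le_degree) auto
  obtain \<mu> where "smult (lead_coeff q) (\<Prod>i<degree q. [:- \<mu> i, 1:]) = q"
    by (rule complex_poly_decompose')
  then have q: "q = (\<Prod>l<k. [:- \<mu> l, 1:])" by (simp add: deg lead)
  define F where "F = (\<Prod>l<k. 1 - fps_const (\<mu> l) * fps_X)"
  define S where "S n = (\<Sum>l<k. \<mu> l ^ n)" for n
  have "F = fps_of_poly (\<Prod>l<k. [:1, - \<mu> l:])"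
    by (simp add: F_def fps_of_poly_prod fps_of_poly_linear' fps_const_neg[symmetric] del: fps_const_neg)
  also have "(\<Prod>l<k. [:1, - \<mu> l:]) = reflect_poly q"
  proof -
    have "[:1, - m:] = reflect_poly [:- m, 1:]" for m :: complex
      by (simp add: reflect_poly_def cCons_def)
    then show ?thesis by (simp only: q reflect_poly_prod)
  qed
  finally have F_nth: "fps_nth F n = f n" if "n \<le> k" for n
    using that coeff_q by (simp add: coeff_reflect_poly deg)
  have S_rec: "of_nat n * f n = - (\<Sum>i<n. f i * S (n - i))" if n: "0 < n" "n \<le> k" for n
  proof -
    have "of_nat n * f n = fps_nth (fps_X * fps_deriv F) n"
      using n by (cases n) (simp_all add: F_nth)
    also have "\<dots> = - (\<Sum>i\<le>n. fps_nth F i * (if n - i = 0 then 0 else S (n - i)))"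
      unfolding F_def fps_newton by (simp add: fps_mult_nth S_def atLeast0AtMost cong: if_cong)
    also have "(\<Sum>i\<le>n. fps_nth F i * (if n - i = 0 then 0 else S (n - i))) = (\<Sum>i<n. f i * S (n - i))"
      unfolding lessThan_Suc_atMost[symmetric] sum.lessThan_Suc
      using n by (auto intro!: sum.cong simp: F_nth)
    finally show ?thesis .
  qed
  \<comment> \<open>\<open>S\<close> and \<open>s\<close> obey the same recursion with the same
    \<open>f\<close>; as \<open>f 0 = 1\<close>, its summand at i = 0 determines the n-th value from
    the earlier ones.\<close>
  have "S n = s n" if "0 < n" "n \<le> k" for n
    using that
  proof (induction n rule: less_induct)
    case (less n)
    obtain m where m: "n = Suc m" using less.prems(1) gr0_implies_Suc by blast
    have "(\<Sum>i<n. f i * S (n - i)) = (\<Sum>i<n. f i * s (n - i))"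
      using S_rec[OF less.prems] f_rec[OF less.prems(1)] by simp
    moreover have "(\<Sum>i<m. f (Suc i) * S (n - Suc i)) = (\<Sum>i<m. f (Suc i) * s (n - Suc i))"
      using less by (intro sum.cong) (auto simp: m)
    ultimately show ?case
      unfolding m sum.lessThan_Suc_shift by (simp add: f0)
  qed
  then show ?thesis by (intro exI[of _ \<mu>]) (auto simp: S_def)
qed

section \<open>Independence over the moment polynomials by specialisation\<close>

text \<open>The coefficients 0, ..., k - 1 are distinct, so permuting the means yields k! different
  linear forms.\<close>

definition mean_form :: "nat \<Rightarrow> (nat \<Rightarrow> complex) \<Rightarrow> complex" where
  "mean_form k x = (\<Sum>l<k. of_nat l * x (2 * k + l))"

lemma poly_fun_mean_form: "poly_fun (mean_form k)"
  unfolding mean_form_def[abs_def] by (intro poly_fun_sum poly_fun_cmult pf_var)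

text \<open>For \<open>v \<le> 2 * k\<close> the first v parameters are frozen, weights at 1 and
  variances at 0. The slices interpolate between the whole space (v = 0) and the power sum case (v =
  2 k).\<close>

definition slice :: "nat \<Rightarrow> nat \<Rightarrow> (nat \<Rightarrow> complex) set" where
  "slice k v = {x \<in> vspace (3 * k). \<forall>w<v. x w = (if w < k then 1 else 0)}"

lemma line_closed_slice: "line_closed (slice k v)"
  by (auto simp: line_closed_def slice_def vspace_def)

lemma slice_not_empty:
  assumes "v \<le> 2 * k"
  shows "slice k v \<noteq> {}"
proof -
  have "(\<lambda>w. if w < k then 1 else 0) \<in> slice k v"
    using assms by (auto simp: slice_def vspace_def)
  then show ?thesis by blast
qed

definition powers_indep_on :: "nat \<Rightarrow> (nat \<Rightarrow> complex) set \<Rightarrow> bool" where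
  "powers_indep_on k W \<longleftrightarrow> (\<forall>c. (\<forall>j. poly_fun (c j)) \<longrightarrow>
     (\<forall>x\<in>W. (\<Sum>j<fact k. c j (moment_map k x) * mean_form k x ^ j) = 0) \<longrightarrow>
     (\<forall>j<fact k. \<forall>y\<in>W. c j y = 0))"

text \<open>The factor theorem in the variable \<open>v\<close>, with the other variables as
  parameters and the quotient again polynomial.\<close>

lemma poly_fun_divide_var:
  assumes "poly_fun C"
  shows "\<exists>C'. poly_fun C' \<and> (\<forall>z. C z = C (z(v := a)) + (z v - a) * C' z)"
  using assms
proof induction
  case (pf_const c)
  then show ?case by (intro exI[of _ "\<lambda>_. 0"]) (simp add: poly_fun.pf_const)
next
  case (pf_var w)
  then show ?case
    by (intro exI[of _ "\<lambda>_. if w = v then 1 else 0"]) (simp add: poly_fun.pf_const)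
next
  case (pf_add p q)
  obtain p' where p': "poly_fun p'" "\<And>z. p z = p (z(v := a)) + (z v - a) * p' z"
    using pf_add.IH(1) by blast
  obtain q' where q': "poly_fun q'" "\<And>z. q z = q (z(v := a)) + (z v - a) * q' z"
    using pf_add.IH(2) by blast
  have "p z + q z = p (z(v := a)) + q (z(v := a)) + (z v - a) * (p' z + q' z)" for z
  proof -
    have p0: "p (z(v := a)) = p z - (z v - a) * p' z" and q0: "q (z(v := a)) = q z - (z v - a) * q' z"
      using p'(2)[of z] q'(2)[of z] by (simp_all add: algebra_simps)
    show ?thesis unfolding p0 q0 by (simp add: algebra_simps)
  qed
  then show ?case using poly_fun.pf_add[OF p'(1) q'(1)] by blast
next
  case (pf_mult p q)
  obtain p' where p': "poly_fun p'" "\<And>z. p z = p (z(v := a)) + (z v - a) * p' z"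
    using pf_mult.IH(1) by blast
  obtain q' where q': "poly_fun q'" "\<And>z. q z = q (z(v := a)) + (z v - a) * q' z"
    using pf_mult.IH(2) by blast
  \<comment> \<open>Leibniz rule for difference quotients; the bracket is
    \<open>p (z(v := a))\<close>, written so that it is visibly polynomial.\<close>
  define r where "r z = p' z * q z + (p z - (z v - a) * p' z) * q' z" for z
  have "poly_fun r"
    unfolding r_def[abs_def]
    by (intro poly_fun.pf_add poly_fun.pf_mult poly_fun_diff p' q' pf_mult.hyps poly_fun.pf_var poly_fun.pf_const)
  moreover have "p z * q z = p (z(v := a)) * q (z(v := a)) + (z v - a) * r z" for z
  proof -
    have p0: "p (z(v := a)) = p z - (z v - a) * p' z" and q0: "q (z(v := a)) = q z - (z v - a) * q' z"
      using p'(2)[of z] q'(2)[of z] by (simp_all add: algebra_simps)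
    show ?thesis unfolding p0 q0 r_def by (simp add: algebra_simps)
  qed
  ultimately show ?case by blast
qed

lemma poly_fun_in_var:
  assumes "poly_fun C"
  shows "\<exists>p. \<forall>t. C (y(v := t)) = poly p t"
proof -
  have "(\<lambda>w. (y(v := 0)) w + t * ((y(v := 1)) w - (y(v := 0)) w)) = y(v := t)" for t
    by auto
  then show ?thesis
    using poly_fun_on_line[OF assms, of "y(v := 0)" "y(v := 1)"] by simp
qed

lemma moment_map_slice:
  assumes "v \<le> 2 * k" "x \<in> slice k v"
  shows "moment_map k x \<in> slice k v"
  using assms moment_map_vspace[of k x] by (auto simp: slice_def moment_map_def)

text \<open>A relation vanishing on the larger slice and all of whose coefficients vanish on the smaller
  one can be divided by the linear equation of the smaller slice.\<close>
lemma powers_indep_on_slice_step: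
  assumes v: "v < 2 * k" and indep: "powers_indep_on k (slice k (Suc v))"
  shows "powers_indep_on k (slice k v)"
proof -
  define a :: complex where "a = (if v < k then 1 else 0)"
  let ?rel = "\<lambda>c x. (\<Sum>j<fact k. c j (moment_map k x) * mean_form k x ^ j)"
  have upd: "z(v := t) \<in> slice k v" if "z \<in> slice k v" for z t
    using that v by (auto simp: slice_def vspace_def)
  have upd': "z(v := a) \<in> slice k (Suc v)" if "z \<in> slice k v" for z
    using that v by (auto simp: slice_def vspace_def a_def less_Suc_eq)
  have sub: "slice k (Suc v) \<subseteq> slice k v" by (auto simp: slice_def)
  \<comment> \<open>A \<open>poly_fun\<close> carries no degree, so the repeated division is
    controlled by one coefficient, restricted to the line through \<open>y\<close> in direction
    \<open>v\<close>: each division lowers the degree of \<open>p\<close>.\<close>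
  have restr_zero: "p = 0" if "\<And>j. poly_fun (c j)" "\<And>x. x \<in> slice k v \<Longrightarrow> ?rel c x = 0"
    "j < fact k" "y \<in> slice k v" "\<And>t. c j (y(v := t)) = poly p t" for c j y p
    using that
  proof (induction "degree p" arbitrary: p c rule: less_induct)
    case less
    show ?case
    proof (rule ccontr)
      assume p: "p \<noteq> 0"
      have zero: "c i z = 0" if "i < fact k" "z \<in> slice k (Suc v)" for i z
        using indep less.prems(1,2) sub that unfolding powers_indep_on_def by blast
      have "\<exists>C. poly_fun C \<and> (\<forall>z. c i z = c i (z(v := a)) + (z v - a) * C z)" for i
        by (rule poly_fun_divide_var[OF less.prems(1)])
      then obtain C where C: "\<And>i. poly_fun (C i)"
        and div: "\<And>i z. c i z = c i (z(v := a)) + (z v - a) * C i z" by metis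
      have cC: "c i z = (z v - a) * C i z" if "i < fact k" "z \<in> slice k v" for i z
        using div[of i z] zero[OF that(1) upd'[OF that(2)]] by simp
      have "(x v - a) * ?rel C x = 0" if x: "x \<in> slice k v" for x
      proof -
        \<comment> \<open>Since the parameter \<open>v\<close> is passed on unchanged, the factor
          \<open>x v - a\<close> comes out of every term of the relation.\<close>
        have "moment_map k x v = x v" using v by (simp add: moment_map_def)
        then have "(x v - a) * ?rel C x = ?rel c x"
          using cC[OF _ moment_map_slice[OF _ x]] v by (simp add: sum_distrib_left mult.assoc)
        then show ?thesis using less.prems(2)[OF x] by simp
      qed
      moreover have "\<exists>x\<in>slice k v. x v - a \<noteq> 0"
        using upd[OF less.prems(4), of "a + 1"] by (intro bexI[of _ "y(v := a + 1)"]) auto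
      moreover have "poly_fun (?rel C)"
        by (intro poly_fun_sum pf_mult poly_fun_power poly_fun_mean_form
            poly_fun_compose[OF C] poly_fun_moment_map)
      ultimately have rel: "?rel C x = 0" if "x \<in> slice k v" for x
        using poly_fun_mult_zero[OF poly_fun_diff[OF pf_var pf_const] _ line_closed_slice] that by blast
      obtain p' where p': "\<And>t. C j (y(v := t)) = poly p' t"
        using poly_fun_in_var[OF C] by metis
      have "poly p t = poly ([:- a, 1:] * p') t" for t
        using cC[OF less.prems(3) upd[OF less.prems(4)], of t] less.prems(5)[of t] p'[of t]
        by (simp add: algebra_simps)
      then have eq: "p = [:- a, 1:] * p'" by (rule poly_ext)
      then have "p' \<noteq> 0" using p by auto
      then have "degree p' < degree p" by (simp add: eq degree_mult_eq del: mult_pCons_left)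
      then have "p' = 0" by (rule less.hyps[OF _ C rel less.prems(3,4) p'])
      then show False using \<open>p' \<noteq> 0\<close> by blast
    qed
  qed
  have "c j y = 0" if "\<And>j. poly_fun (c j)" "\<And>x. x \<in> slice k v \<Longrightarrow> ?rel c x = 0"
    "j < fact k" "y \<in> slice k v" for c j y
  proof -
    have "\<exists>p. \<forall>t. c j (y(v := t)) = poly p t" by (rule poly_fun_in_var[OF that(1)])
    then obtain p where p: "\<And>t. c j (y(v := t)) = poly p t" by blast
    have "p = 0" by (rule restr_zero[OF that p])
    then show ?thesis using p[of "y v"] by simp
  qed
  then show ?thesis unfolding powers_indep_on_def by blast
qed

section \<open>Symmetry of power sums under permutations of the means\<close>

definition permute_means :: "nat \<Rightarrow> (nat \<Rightarrow> nat) \<Rightarrow> (nat \<Rightarrow> complex) \<Rightarrow> nat \<Rightarrow> complex" where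
  "permute_means k \<sigma> x v = (if 2 * k \<le> v \<and> v < 3 * k then x (2 * k + \<sigma> (v - 2 * k)) else x v)"

lemma mean_form_permute: "mean_form k (permute_means k \<sigma> x) = (\<Sum>l<k. of_nat l * x (2 * k + \<sigma> l))"
  unfolding mean_form_def by (rule sum.cong) (auto simp: permute_means_def)

lemma permute_means_slice:
  assumes "x \<in> slice k (2 * k)"
  shows "permute_means k \<sigma> x \<in> slice k (2 * k)"
  using assms by (auto simp: slice_def vspace_def permute_means_def)

lemma Mom_variance_zero: "Mom i \<mu> 0 = \<mu> ^ i"
  by (induction i rule: induct_nat_012) auto

lemma moment_map_power_sum:
  assumes "x \<in> slice k (2 * k)" "2 * k \<le> v" "v < 3 * k"
  shows "moment_map k x v = (\<Sum>l<k. x (2 * k + l) ^ (v - 2 * k + 1))"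
proof -
  have "(\<Sum>l<k. x l * Mom (v - 2 * k + 1) (x (2 * k + l)) (x (k + l))) = (\<Sum>l<k. x (2 * k + l) ^ (v - 2 * k + 1))"
    by (rule sum.cong) (use assms(1) in \<open>auto simp: slice_def Mom_variance_zero simp del: Mom.simps\<close>)
  then show ?thesis using assms by (simp add: moment_map_def)
qed

lemma moment_map_permute:
  assumes "x \<in> slice k (2 * k)" "\<sigma> permutes {..<k}"
  shows "moment_map k (permute_means k \<sigma> x) = moment_map k x"
proof
  fix v
  show "moment_map k (permute_means k \<sigma> x) v = moment_map k x v"
  proof (cases "2 * k \<le> v \<and> v < 3 * k")
    case True
    have "(\<Sum>l<k. permute_means k \<sigma> x (2 * k + l) ^ (v - 2 * k + 1)) = (\<Sum>l<k. x (2 * k + \<sigma> l) ^ (v - 2 * k + 1))"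
      by (rule sum.cong) (auto simp: permute_means_def)
    also have "\<dots> = (\<Sum>l<k. x (2 * k + l) ^ (v - 2 * k + 1))"
      using sum.permute[OF assms(2), of "\<lambda>l. x (2 * k + l) ^ (v - 2 * k + 1)"] by (simp add: o_def)
    finally show ?thesis
      using True assms(1) by (simp only: moment_map_power_sum permute_means_slice)
  next
    case False
    then show ?thesis by (auto simp: moment_map_def permute_means_def)
  qed
qed

lemma moment_map_slice_surjective:
  assumes "y \<in> slice k (2 * k)"
  shows "\<exists>x\<in>slice k (2 * k). moment_map k x = y"
proof -
  obtain \<mu> where \<mu>: "\<And>n. n \<in> {1..k} \<Longrightarrow> (\<Sum>l<k. \<mu> l ^ n) = y (2 * k + n - 1)"
    using power_sums_surjective[of k "\<lambda>n. y (2 * k + n - 1)"] by blast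
  define x where "x v = (if 2 * k \<le> v \<and> v < 3 * k then \<mu> (v - 2 * k) else y v)" for v
  have x: "x \<in> slice k (2 * k)" using assms by (auto simp: slice_def vspace_def x_def)
  have "moment_map k x v = y v" for v
  proof (cases "2 * k \<le> v \<and> v < 3 * k")
    case True
    have "(\<Sum>l<k. x (2 * k + l) ^ (v - 2 * k + 1)) = (\<Sum>l<k. \<mu> l ^ (v - 2 * k + 1))"
      by (rule sum.cong) (auto simp: x_def)
    then show ?thesis using True \<mu>[of "v - 2 * k + 1"] moment_map_power_sum[OF x] by auto
  next
    case False
    then show ?thesis using assms by (auto simp: moment_map_def x_def slice_def vspace_def)
  qed
  then show ?thesis using x by blast
qed

lemma mean_form_separates_permutations:
  assumes \<sigma>: "\<sigma> permutes {..<k}" and \<tau>: "\<tau> permutes {..<k}" and "\<sigma> \<noteq> \<tau>"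
  shows "\<exists>x\<in>slice k (2 * k). mean_form k (permute_means k \<sigma> x) \<noteq> mean_form k (permute_means k \<tau> x)"
proof -
  obtain l where l: "\<sigma> l \<noteq> \<tau> l" using assms(3) by blast
  then have lk: "l < k" using \<sigma> \<tau> by (metis lessThan_iff permutes_not_in)
  define m where "m = \<sigma> l"
  have mk: "m < k" using lk \<sigma> by (metis lessThan_iff permutes_in_image m_def)
  \<comment> \<open>Only the mean with index \<open>m\<close> is nonzero, so for a permutation rho
    the form reads off the place l with rho l = m.\<close>
  define x :: "nat \<Rightarrow> complex" where "x v = (if v < k then 1 else if v = 2 * k + m then 1 else 0)" for v
  have x: "x \<in> slice k (2 * k)" using mk by (auto simp: x_def slice_def vspace_def)
  have val: "mean_form k (permute_means k \<rho> x) = of_nat (inv \<rho> m)" if \<rho>: "\<rho> permutes {..<k}" for \<rho>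
  proof -
    have "mean_form k (permute_means k \<rho> x) = (\<Sum>i<k. if i = inv \<rho> m then of_nat i else 0)"
      unfolding mean_form_permute
    proof (rule sum.cong)
      fix i assume "i \<in> {..<k}"
      have "\<rho> i = m \<longleftrightarrow> i = inv \<rho> m" using permutes_inv_eq[OF \<rho>, of m i] by auto
      then show "of_nat i * x (2 * k + \<rho> i) = (if i = inv \<rho> m then of_nat i else 0)"
        using \<open>i \<in> {..<k}\<close> by (simp add: x_def)
    qed simp
    moreover have "inv \<rho> m < k"
      using permutes_in_image[OF permutes_inv[OF \<rho>]] mk by simp
    ultimately show ?thesis by simp
  qed
  have "inv \<sigma> m = l" using permutes_inv_eq[OF \<sigma>] by (simp add: m_def)
  moreover have "inv \<tau> m \<noteq> l" using permutes_inv_eq[OF \<tau>] l by (simp add: m_def)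
  ultimately have "mean_form k (permute_means k \<sigma> x) \<noteq> mean_form k (permute_means k \<tau> x)"
    by (simp add: val \<sigma> \<tau>)
  then show ?thesis using x by blast
qed

lemma poly_fun_permute_means: "poly_fun (\<lambda>x. permute_means k \<sigma> x v)"
  unfolding permute_means_def by (cases "2 * k \<le> v \<and> v < 3 * k") (auto intro: pf_var)

text \<open>For unit weights and zero variances the moments are power sums, so a relation for \<open>mean_form\<close>
  has all \<open>k!\<close> permuted values as roots.\<close>
lemma powers_indep_on_power_sums: "powers_indep_on k (slice k (2 * k))"
  unfolding powers_indep_on_def
proof (intro allI impI ballI)
  fix c :: "nat \<Rightarrow> (nat \<Rightarrow> complex) \<Rightarrow> complex" and j :: nat and y
  assume c: "\<forall>j. poly_fun (c j)" and j: "j < fact k" and y: "y \<in> slice k (2 * k)"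
    and rel: "\<forall>x\<in>slice k (2 * k). (\<Sum>j<fact k. c j (moment_map k x) * mean_form k x ^ j) = 0"
  show "c j y = 0"
  proof (rule ccontr)
    assume nz: "c j y \<noteq> 0"
    define P where "P = {\<sigma>. \<sigma> permutes {..<k}}"
    have finP: "finite P" and cardP: "card P = fact k"
      by (simp_all add: P_def finite_permutations card_permutations)
    define R where "R = {(\<sigma>, \<tau>) \<in> P \<times> P. \<sigma> \<noteq> \<tau>}"
    have finR: "finite R" unfolding R_def by (rule finite_subset[of _ "P \<times> P"]) (auto simp: finP)
    define diff where "diff st x = mean_form k (permute_means k (fst st) x) - mean_form k (permute_means k (snd st) x)"
      for st x
    have diff_poly: "poly_fun (diff st)" for st
      unfolding diff_def[abs_def]
      by (intro poly_fun_diff poly_fun_compose[OF poly_fun_mean_form] poly_fun_permute_means)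
    have "\<exists>x\<in>slice k (2 * k). (\<Prod>st\<in>R. diff st x) \<noteq> 0"
    proof (rule poly_fun_prod_nonzero[OF finR line_closed_slice slice_not_empty diff_poly])
      fix st assume "st \<in> R"
      then show "\<exists>x\<in>slice k (2 * k). diff st x \<noteq> 0"
        using mean_form_separates_permutations[of "fst st" k "snd st"]
        by (auto simp: R_def P_def diff_def)
    qed simp
    then obtain b where b: "b \<in> slice k (2 * k)" "(\<Prod>st\<in>R. diff st b) \<noteq> 0" by blast
    \<comment> \<open>Surjectivity turns nonvanishing of \<open>c j\<close> at \<open>y\<close> into
      nonvanishing of \<open>c j\<close> composed with \<open>moment_map\<close> on the slice, where
      it can be combined with distinctness of all permuted values.\<close>
    obtain x0 where x0: "x0 \<in> slice k (2 * k)" "moment_map k x0 = y"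
      using moment_map_slice_surjective[OF y] by blast
    have "poly_fun (\<lambda>x. c j (moment_map k x))"
      by (rule poly_fun_compose[OF spec[OF c] poly_fun_moment_map])
    then obtain x where x: "x \<in> slice k (2 * k)" "c j (moment_map k x) \<noteq> 0" "(\<Prod>st\<in>R. diff st x) \<noteq> 0"
      using poly_fun_common_nonzero[OF _ poly_fun_prod[of R diff] line_closed_slice x0(1) _ b]
        diff_poly nz x0(2) by metis
    define p where "p = (\<Sum>i<fact k. monom (c i (moment_map k x)) i)"
    have coeff_p: "coeff p i = (if i < fact k then c i (moment_map k x) else 0)" for i
      by (simp add: p_def coeff_sum)
    have "p \<noteq> 0" using coeff_p[of j] j x(2) by auto
    define root where "root \<sigma> = mean_form k (permute_means k \<sigma> x)" for \<sigma>
    have "inj_on root P"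
    proof (rule inj_onI, rule ccontr)
      fix \<sigma> \<tau> assume "\<sigma> \<in> P" "\<tau> \<in> P" "root \<sigma> = root \<tau>" "\<sigma> \<noteq> \<tau>"
      then have "(\<sigma>, \<tau>) \<in> R" "diff (\<sigma>, \<tau>) x = 0" by (simp_all add: R_def diff_def root_def)
      then show False using x(3) finR by auto
    qed
    moreover have "root ` P \<subseteq> {t. poly p t = 0}"
    proof clarify
      fix \<sigma> assume "\<sigma> \<in> P"
      then have "moment_map k (permute_means k \<sigma> x) = moment_map k x"
        using moment_map_permute[OF x(1)] by (simp add: P_def)
      then show "poly p (root \<sigma>) = 0"
        using bspec[OF rel permute_means_slice[OF x(1), of \<sigma>]]
        by (simp add: p_def poly_sum poly_monom root_def)
    qed
    ultimately have "fact k \<le> card {t. poly p t = 0}"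
      using card_inj_on_le[of root P] poly_roots_finite[OF \<open>p \<noteq> 0\<close>] cardP by metis
    also have "\<dots> \<le> degree p" by (rule card_poly_roots_bound) fact
    also have "degree p < fact k"
      using \<open>p \<noteq> 0\<close> coeff_p[of "degree p"] leading_coeff_0_iff[of p] by (metis not_le_imp_less linorder_not_less)
    finally show False by simp
  qed
qed

text \<open>Descending induction on v: starting from power sums, the variances and then the weights
  are released one at a time.\<close>

lemma powers_indep: "powers_indep_on k (vspace (3 * k))"
proof -
  have "powers_indep_on k (slice k v)" if "v \<le> 2 * k" for v
    using that
  proof (induction rule: inc_induct)
    case base
    show ?case by (rule powers_indep_on_power_sums)
  next
    case (step v)
    then show ?case by (auto intro: powers_indep_on_slice_step[of v])
  qed
  from this[of 0] show ?thesis by (simp add: slice_def)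
qed


section \<open>Generic number of solutions\<close>

lemma enc_vspace: "enc k lam s m \<in> vspace (3 * k)"
  by (simp add: enc_def vspace_def)

lemma vspace_enc:
  assumes "y \<in> vspace (3 * k)"
  shows "\<exists>lam s m. enc k lam s m = y"
proof -
  have "enc k (\<lambda>i. y (i - 1)) (\<lambda>i. y (k + i - 1)) (\<lambda>i. y (2 * k + i - 1)) = y"
    using assms by (auto simp: enc_def vspace_def fun_eq_iff)
  then show ?thesis by blast
qed

lemma moment_map_enc:
  assumes "i \<in> {1..k}"
  shows "moment_map k (enc k lam s mu) (2 * k + i - 1) = (\<Sum>l=1..k. lam l * Mom i (mu l) (s l))"
proof -
  have "(\<Sum>l=1..k. lam l * Mom i (mu l) (s l)) = (\<Sum>l<k. lam (l + 1) * Mom i (mu (l + 1)) (s (l + 1)))"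
    by (simp add: sum.atLeast1_atMost_eq)
  also have "\<dots> = moment_map k (enc k lam s mu) (2 * k + i - 1)"
    using assms by (auto simp: moment_map_def enc_def intro!: sum.cong)
  finally show ?thesis by simp
qed

lemma moment_map_eq_enc_iff:
  "moment_map k (enc k lam s mu) = enc k lam s m \<longleftrightarrow> (\<forall>i\<in>{1..k}. hsys k lam s m mu i = 0)"
proof
  assume eq: "moment_map k (enc k lam s mu) = enc k lam s m"
  show "\<forall>i\<in>{1..k}. hsys k lam s m mu i = 0"
  proof
    fix i assume i: "i \<in> {1..k}"
    have "enc k lam s m (2 * k + i - 1) = m i" using i by (auto simp: enc_def)
    then show "hsys k lam s m mu i = 0"
      using moment_map_enc[OF i, of lam s mu] by (simp add: hsys_def eq)
  qed
next
  assume sol: "\<forall>i\<in>{1..k}. hsys k lam s m mu i = 0"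
  show "moment_map k (enc k lam s mu) = enc k lam s m"
  proof
    fix v
    show "moment_map k (enc k lam s mu) v = enc k lam s m v"
    proof (cases "2 * k \<le> v \<and> v < 3 * k")
      case True
      then have i: "v - 2 * k + 1 \<in> {1..k}" by auto
      have "hsys k lam s m mu (v - 2 * k + 1) = 0" using sol i by blast
      then show ?thesis
        using moment_map_enc[OF i, of lam s mu] True by (simp add: hsys_def enc_def)
    next
      case False
      then show ?thesis by (auto simp: moment_map_def enc_def)
    qed
  qed
qed

text \<open>A fibre point has its weights and variances prescribed, so it is determined by its
  means; the third block of \<open>enc\<close> holds means in the source and moments in the target.
  The decoding is a restricted function because \<open>solutions\<close> consists of extensional
  ones.\<close>

lemma bij_betw_solutions:
  "bij_betw (\<lambda>mu. enc k lam s mu) (solutions k lam s m)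
     {x \<in> vspace (3 * k). moment_map k x = enc k lam s m}"
proof (rule bij_betw_byWitness[of _ "\<lambda>x. \<lambda>i\<in>{1..k}. x (2 * k + i - 1)"])
  let ?dec = "\<lambda>x. \<lambda>i\<in>{1..k}. x (2 * k + i - 1)"
  show "\<forall>mu\<in>solutions k lam s m. ?dec (enc k lam s mu) = mu"
  proof
    fix mu assume "mu \<in> solutions k lam s m"
    then have ext: "mu \<in> {1..k} \<rightarrow>\<^sub>E UNIV" by (simp add: solutions_def)
    show "?dec (enc k lam s mu) = mu"
    proof
      fix i
      show "?dec (enc k lam s mu) i = mu i"
        using ext by (cases "i \<in> {1..k}") (auto simp: enc_def PiE_def extensional_def)
    qed
  qed
  have enc_dec: "enc k lam s (?dec x) = x"
    if x: "x \<in> vspace (3 * k)" "moment_map k x = enc k lam s m" for x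
  proof
    fix v
    have "x v = enc k lam s m v" if "v < 2 * k"
      using fun_cong[OF x(2), of v] that by (simp add: moment_map_def)
    then show "enc k lam s (?dec x) v = x v"
      using x(1) by (auto simp: enc_def vspace_def)
  qed
  then show "\<forall>x\<in>{x \<in> vspace (3 * k). moment_map k x = enc k lam s m}. enc k lam s (?dec x) = x"
    by blast
  show "(\<lambda>mu. enc k lam s mu) ` solutions k lam s m \<subseteq> {x \<in> vspace (3 * k). moment_map k x = enc k lam s m}"
    by (auto simp: solutions_def moment_map_eq_enc_iff enc_vspace)
  show "?dec ` {x \<in> vspace (3 * k). moment_map k x = enc k lam s m} \<subseteq> solutions k lam s m"
  proof (rule image_subsetI)
    fix x assume "x \<in> {x \<in> vspace (3 * k). moment_map k x = enc k lam s m}"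
    then have "moment_map k (enc k lam s (?dec x)) = enc k lam s m"
      using enc_dec[of x] by simp
    then show "?dec x \<in> solutions k lam s m"
      unfolding moment_map_eq_enc_iff solutions_def by simp
  qed
qed

theorem mainTheorem9:
  fixes k :: nat
  assumes "k \<ge> 1"
  shows "generic k (\<lambda>lam s m. finite (solutions k lam s m) \<and> card (solutions k lam s m) = fact k)"
proof -
  interpret generic_fibre "3 * k" "fact k" "moment_map k" "mean_form k"
  proof
    fix c :: "nat \<Rightarrow> (nat \<Rightarrow> complex) \<Rightarrow> complex" and j :: nat and y
    assume "\<And>j. poly_fun (c j)" "j < fact k" "y \<in> vspace (3 * k)"
      "\<And>x. x \<in> vspace (3 * k) \<Longrightarrow> (\<Sum>j<fact k. c j (moment_map k x) * mean_form k x ^ j) = 0"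
    then show "c j y = 0" using powers_indep[of k] unfolding powers_indep_on_def by blast
  qed (use poly_fun_moment_map moment_map_vspace poly_fun_mean_form dependent_over_moments in auto)
  obtain P where P: "poly_fun P" "\<exists>y\<in>vspace (3 * k). P y \<noteq> 0"
    and fibre: "\<And>y. y \<in> vspace (3 * k) \<Longrightarrow> P y \<noteq> 0 \<Longrightarrow>
      finite {x \<in> vspace (3 * k). moment_map k x = y} \<and> card {x \<in> vspace (3 * k). moment_map k x = y} = fact k"
    using card_generic_fibre by blast
  have "\<exists>lam s m. P (enc k lam s m) \<noteq> 0"
    using P(2) vspace_enc by metis
  moreover have "finite (solutions k lam s m) \<and> card (solutions k lam s m) = fact k"
    if "P (enc k lam s m) \<noteq> 0" for lam s m
    using fibre[OF enc_vspace that] bij_betw_finite[OF bij_betw_solutions]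
      bij_betw_same_card[OF bij_betw_solutions] by metis
  ultimately show ?thesis using P(1) unfolding generic_def by blast
qed

end
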